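(* Consider the deterministic control problem described in the context, and assume all of its standing assumptions (1)--(6). Suppose moreover that $g$ is convex and that for each $t\in[0,T]$ and $p\in\mathbb{R}^d$ the map $(x,u)\mapsto\mathcal{H}_t^0(x,p,u)$ is concave on $\mathbb{R}^d\times U$. Then, for all $u,v\in\mathcal{U}$, $$J^\tau(v)-J^\tau(u)\ge dJ^\tau(u)(v-u)+\tau\,\mathcal{D}_h(v\mid u).$$ Equivalently, $$J^\tau(v)-J^\tau(u)\ge-\int_0^T\nabla_u\mathcal{H}_t^\tau(x_t,p_t,u_t)\cdot(v_t-u_t)\,dt+\tau\int_0^T D_h(v_t\mid u_t)\,dt,$$ where $(x,p)$ is the state-adjoint pair associated with $u$.
   Context: Control problem. Fix $T>0$, $x_0\in\mathbb{R}^d$, $\tau\ge 0$, a set $U\subset\mathbb{R}^m$, and maps $b:[0,T]\times\mathbb{R}^d\times U\to\mathbb{R}^d$, $f:[0,T]\times\mathbb{R}^d\times U\to\mathbb{R}$, $g:\mathbb{R}^d\to\mathbb{R}$, $h:U\to\mathbb{R}$; write $b_t(x,u)=b(t,x,u)$ and $f_t(x,u)=f(t,x,u)$. The control space is $\mathcal{U}:=C([0,T];U)$. For $u\in\mathcal{U}$ the state $x$ is the solution of $\dot x_t=b_t(x_t,u_t)$ on $[0,T]$ with initial value $x_0$. The cost is $$J^\tau(u)=\int_0^T\bigl(f_t(x_t,u_t)+\tau h(u_t)\bigr)\,dt+g(x_T).$$ Hamiltonians: $\mathcal{H}_t^0(x,p,u)=p\cdot b_t(x,u)-f_t(x,u)$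 and $\mathcal{H}_t^\tau(x,p,u)=\mathcal{H}_t^0(x,p,u)-\tau h(u)$, so $\nabla_u\mathcal{H}_t^\tau(x,p,u)=\nabla_u b_t(x,u)^\top p-\nabla_u f_t(x,u)-\tau\nabla h(u)$. The adjoint $p$ associated with $u$ (and its state $x$) is the solution of $\dot p_t=-\nabla_x\mathcal{H}_t^0(x_t,p_t,u_t)$, $p_T=-\nabla g(x_T)$. For every $u\in\mathcal{U}$ the state and adjoint exist and are unique under the standing assumptions. Norms: $|\cdot|$ is the Euclidean norm of vectors and the spectral norm of matrices; $\|\cdot\|$ is the operator norm. Standing assumptions: (1) $U$ is a nonempty, closed, convex subset of $\mathbb{R}^m$. (2) $b$ and $f$ are continuous, and there is $M>0$ such that for $\varphi=b,f$: $|\varphi_t(x,u)-\varphi_t(x',u')|\le M(|x-x'|+|u-u'|)$ and $|\varphi_t(0,u)|\le M$ for all $t\in[0,T]$, $x,x'\in\mathbb{R}^d$, $u,u'\in U$. (3) For $\varphi=b,f$, $\varphi_t(x,u)$ is twice continuously differentiable in $(x,u)$, and, with the same $M$ (possibly increased), $|\nabla_x\varphi_t(x,u)-\nabla_x\varphi_t(x',u')|\le M(|x-x'|+|u-u'|)$ for all $t,x,x',u,u'$. There are constants $M_{b,uu},M_{f,uu}>0$ with $\|\nabla^2_{uu}b_t(x,u)\|\le M_{b,uu}$ and $\|\nabla^2_{uu}f_t(x,u)\|\le M_{f,uu}$ for all $(t,x,u)$. (Consequently $\nabla_x b,\nabla_u b,\nabla_x f,\nabla_u f$ and $\nabla^2_{xx}b,\nabla^2_{xu}b,\nabla^2_{xx}f,\nabla^2_{xu}f$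 are uniformly bounded by $M$.) (4) $g$ is continuously differentiable with $\max\{|g(x)-g(x')|,|\nabla g(x)-\nabla g(x')|\}\le M|x-x'|$ for all $x,x'$, and $|g(0)|\le M$. (5) $h$ is convex and continuously differentiable. (6) There exists $u^*\in\mathcal{U}$ minimizing $J^\tau$ over $\mathcal{U}$. Bregman divergences: $D_h(v\mid u)=h(v)-h(u)-\nabla h(u)\cdot(v-u)$ for $u,v\in U$, and $\mathcal{D}_h(v\mid u)=\int_0^T D_h(v_t\mid u_t)\,dt$ for $u,v\in\mathcal{U}$. Directional derivative: for $u,v\in\mathcal{U}$, $dJ^\tau(u)(v-u):=\lim_{\varepsilon\to0^+}\varepsilon^{-1}\bigl(J^\tau(u+\varepsilon(v-u))-J^\tau(u)\bigr)$; under the standing assumptions it exists and equals $-\int_0^T\nabla_u\mathcal{H}_t^\tau(x_t,p_t,u_t)\cdot(v_t-u_t)\,dt$, where $(x,p)$ is the state-adjoint pair of $u$. *)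

theory Defs
  imports "HOL-Analysis.Analysis"
begin

section \<open>Partial derivatives read off a total derivative\<close>

text \<open>Norms of bounded linear functions are operator norms; in particular the norm of
  \<open>part_x A\<close> is the spectral norm of the corresponding matrix.\<close>

definition inj_x :: "'a::real_normed_vector \<Rightarrow>\<^sub>L ('a \<times> 'b::real_normed_vector)"
  where "inj_x = Blinfun (\<lambda>k. (k, 0))"

definition inj_u :: "'b::real_normed_vector \<Rightarrow>\<^sub>L ('a::real_normed_vector \<times> 'b)"
  where "inj_u = Blinfun (\<lambda>k. (0, k))"

definition part_x ::
    "(('a::real_normed_vector \<times> 'b::real_normed_vector) \<Rightarrow>\<^sub>L 'c::real_normed_vector) \<Rightarrow> 'a \<Rightarrow>\<^sub>L 'c"
  where "part_x A = A o\<^sub>L inj_x"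

definition part_u ::
    "(('a::real_normed_vector \<times> 'b::real_normed_vector) \<Rightarrow>\<^sub>L 'c::real_normed_vector) \<Rightarrow> 'b \<Rightarrow>\<^sub>L 'c"
  where "part_u A = A o\<^sub>L inj_u"

definition part_uu ::
    "(('a::real_normed_vector \<times> 'b::real_normed_vector) \<Rightarrow>\<^sub>L (('a \<times> 'b) \<Rightarrow>\<^sub>L 'c::real_normed_vector))
      \<Rightarrow> 'b \<Rightarrow>\<^sub>L ('b \<Rightarrow>\<^sub>L 'c)"
  where "part_uu B = Blinfun (\<lambda>k. part_u (part_u B k))"

lemma inj_x_apply [simp]: "blinfun_apply inj_x k = (k, 0)"
  unfolding inj_x_def
  by (simp add: bounded_linear_Blinfun_apply bounded_linear_Pair)

lemma inj_u_apply [simp]: "blinfun_apply inj_u k = (0, k)"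
  unfolding inj_u_def
  by (simp add: bounded_linear_Blinfun_apply bounded_linear_Pair)

lemma part_x_apply [simp]: "blinfun_apply (part_x A) k = blinfun_apply A (k, 0)"
  by (simp add: part_x_def)

lemma part_u_apply [simp]: "blinfun_apply (part_u A) k = blinfun_apply A (0, k)"
  by (simp add: part_u_def)

lemma part_uu_apply [simp]:
  "blinfun_apply (blinfun_apply (part_uu B) k) l = blinfun_apply (blinfun_apply B (0, k)) (0, l)"
proof -
  have "bounded_linear (\<lambda>k. part_u (part_u B k))"
    unfolding part_u_def
    by (intro bounded_linear_intros blinfun.bounded_linear_right)
  then show ?thesis
    by (simp add: part_uu_def bounded_linear_Blinfun_apply)
qed

text \<open>The gradient vector representing a linear functional.\<close>

definition grad_vec :: "('a::euclidean_space \<Rightarrow>\<^sub>L real) \<Rightarrow> 'a"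
  where "grad_vec A = adjoint (blinfun_apply A) 1"

lemma grad_vec_inner: "grad_vec A \<bullet> k = blinfun_apply A k"
proof -
  have "k \<bullet> adjoint (blinfun_apply A) 1 = blinfun_apply A k \<bullet> 1"
    by (rule adjoint_works) (simp add: blinfun.bounded_linear_right bounded_linear.linear)
  then show ?thesis
    by (simp add: grad_vec_def inner_commute)
qed


section \<open>Conditions on the coefficients\<close>

definition lipschitz_coeff ::
    "real \<Rightarrow> (real^'m) set \<Rightarrow> real \<Rightarrow> (real \<Rightarrow> real^'d \<Rightarrow> real^'m \<Rightarrow> 'c::real_normed_vector) \<Rightarrow> bool"
  where
  "lipschitz_coeff T U M \<phi> \<longleftrightarrow>
     continuous_on ({0..T} \<times> UNIV \<times> U) (\<lambda>(t, x, u). \<phi> t x u) \<and>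
     (\<forall>t\<in>{0..T}. \<forall>x x'. \<forall>u\<in>U. \<forall>u'\<in>U.
        norm (\<phi> t x u - \<phi> t x' u') \<le> M * (norm (x - x') + norm (u - u'))) \<and>
     (\<forall>t\<in>{0..T}. \<forall>u\<in>U. norm (\<phi> t 0 u) \<le> M)"

text \<open>\<open>\<phi>'\<close> and \<open>\<phi>''\<close> are the first and second total derivatives of
  \<open>(x, u) \<mapsto> \<phi> t x u\<close> on \<open>UNIV \<times> U\<close>. They are parameters because \<open>U\<close> may have empty interior,
  in which case derivatives within \<open>UNIV \<times> U\<close> are determined only along directions
  tangent to the affine hull of \<open>U\<close>; any choice with the stated regularity is admitted.\<close>

definition smooth_coeff ::
    "real \<Rightarrow> (real^'m) set \<Rightarrow> real \<Rightarrow> real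
      \<Rightarrow> (real \<Rightarrow> real^'d \<Rightarrow> real^'m \<Rightarrow> 'c::real_normed_vector)
      \<Rightarrow> (real \<Rightarrow> real^'d \<Rightarrow> real^'m \<Rightarrow> (((real^'d) \<times> (real^'m)) \<Rightarrow>\<^sub>L 'c))
      \<Rightarrow> (real \<Rightarrow> real^'d \<Rightarrow> real^'m \<Rightarrow> (((real^'d) \<times> (real^'m)) \<Rightarrow>\<^sub>L (((real^'d) \<times> (real^'m)) \<Rightarrow>\<^sub>L 'c)))
      \<Rightarrow> bool"
  where
  "smooth_coeff T U M Muu \<phi> \<phi>' \<phi>'' \<longleftrightarrow>
     (\<forall>t\<in>{0..T}. \<forall>x. \<forall>u\<in>U.
        ((\<lambda>(x, u). \<phi> t x u) has_derivative blinfun_apply (\<phi>' t x u)) (at (x, u) within UNIV \<times> U)) \<and>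
     (\<forall>t\<in>{0..T}. \<forall>x. \<forall>u\<in>U.
        ((\<lambda>(x, u). \<phi>' t x u) has_derivative blinfun_apply (\<phi>'' t x u)) (at (x, u) within UNIV \<times> U)) \<and>
     (\<forall>t\<in>{0..T}. continuous_on (UNIV \<times> U) (\<lambda>(x, u). \<phi>'' t x u)) \<and>
     (\<forall>t\<in>{0..T}. \<forall>x x'. \<forall>u\<in>U. \<forall>u'\<in>U.
        norm (part_x (\<phi>' t x u) - part_x (\<phi>' t x' u')) \<le> M * (norm (x - x') + norm (u - u'))) \<and>
     (\<forall>t\<in>{0..T}. \<forall>x. \<forall>u\<in>U. norm (part_uu (\<phi>'' t x u)) \<le> Muu)"


section \<open>The control problem\<close>

text \<open>Controls, states and costates are total functions of which only the values on
  \<open>{0..T}\<close> matter.\<close>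

definition controls :: "real \<Rightarrow> (real^'m) set \<Rightarrow> (real \<Rightarrow> real^'m) set"
  where "controls T U = {u. continuous_on {0..T} u \<and> u ` {0..T} \<subseteq> U}"

definition is_state ::
    "real \<Rightarrow> real^'d \<Rightarrow> (real \<Rightarrow> real^'d \<Rightarrow> real^'m \<Rightarrow> real^'d)
      \<Rightarrow> (real \<Rightarrow> real^'m) \<Rightarrow> (real \<Rightarrow> real^'d) \<Rightarrow> bool"
  where
  "is_state T x0 b u x \<longleftrightarrow>
     x 0 = x0 \<and>
     (\<forall>t\<in>{0..T}. (x has_vector_derivative b t (x t) (u t)) (at t within {0..T}))"

text \<open>For Lipschitz coefficients the state exists and is unique on \<open>{0..T}\<close>.\<close>

definition state ::
    "real \<Rightarrow> real^'d \<Rightarrow> (real \<Rightarrow> real^'d \<Rightarrow> real^'m \<Rightarrow> real^'d) \<Rightarrow> (real \<Rightarrow> real^'m) \<Rightarrow> real \<Rightarrow> real^'d"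
  where "state T x0 b u = (SOME x. is_state T x0 b u x)"

definition cost ::
    "real \<Rightarrow> real^'d \<Rightarrow> real \<Rightarrow> (real \<Rightarrow> real^'d \<Rightarrow> real^'m \<Rightarrow> real^'d)
      \<Rightarrow> (real \<Rightarrow> real^'d \<Rightarrow> real^'m \<Rightarrow> real) \<Rightarrow> (real^'d \<Rightarrow> real) \<Rightarrow> (real^'m \<Rightarrow> real)
      \<Rightarrow> (real \<Rightarrow> real^'m) \<Rightarrow> real"
  where
  "cost T x0 \<tau> b f g h u =
     integral {0..T} (\<lambda>t. f t (state T x0 b u t) (u t) + \<tau> * h (u t)) + g (state T x0 b u T)"

definition hamiltonian0 ::
    "(real \<Rightarrow> real^'d \<Rightarrow> real^'m \<Rightarrow> real^'d) \<Rightarrow> (real \<Rightarrow> real^'d \<Rightarrow> real^'m \<Rightarrow> real)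
      \<Rightarrow> real \<Rightarrow> real^'d \<Rightarrow> real^'d \<Rightarrow> real^'m \<Rightarrow> real"
  where "hamiltonian0 b f t x p u = p \<bullet> b t x u - f t x u"

definition hamiltonian ::
    "real \<Rightarrow> (real \<Rightarrow> real^'d \<Rightarrow> real^'m \<Rightarrow> real^'d) \<Rightarrow> (real \<Rightarrow> real^'d \<Rightarrow> real^'m \<Rightarrow> real)
      \<Rightarrow> (real^'m \<Rightarrow> real) \<Rightarrow> real \<Rightarrow> real^'d \<Rightarrow> real^'d \<Rightarrow> real^'m \<Rightarrow> real"
  where "hamiltonian \<tau> b f h t x p u = hamiltonian0 b f t x p u - \<tau> * h u"

definition grad_x_hamiltonian0 ::
    "(real \<Rightarrow> real^'d \<Rightarrow> real^'m \<Rightarrow> (((real^'d) \<times> (real^'m)) \<Rightarrow>\<^sub>L (real^'d)))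
      \<Rightarrow> (real \<Rightarrow> real^'d \<Rightarrow> real^'m \<Rightarrow> (((real^'d) \<times> (real^'m)) \<Rightarrow>\<^sub>L real))
      \<Rightarrow> real \<Rightarrow> real^'d \<Rightarrow> real^'d \<Rightarrow> real^'m \<Rightarrow> real^'d"
  where
  "grad_x_hamiltonian0 b' f' t x p u =
     adjoint (blinfun_apply (part_x (b' t x u))) p - grad_vec (part_x (f' t x u))"

definition grad_u_hamiltonian ::
    "real \<Rightarrow> (real \<Rightarrow> real^'d \<Rightarrow> real^'m \<Rightarrow> (((real^'d) \<times> (real^'m)) \<Rightarrow>\<^sub>L (real^'d)))
      \<Rightarrow> (real \<Rightarrow> real^'d \<Rightarrow> real^'m \<Rightarrow> (((real^'d) \<times> (real^'m)) \<Rightarrow>\<^sub>L real))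
      \<Rightarrow> (real^'m \<Rightarrow> real^'m)
      \<Rightarrow> real \<Rightarrow> real^'d \<Rightarrow> real^'d \<Rightarrow> real^'m \<Rightarrow> real^'m"
  where
  "grad_u_hamiltonian \<tau> b' f' h' t x p u =
     adjoint (blinfun_apply (part_u (b' t x u))) p - grad_vec (part_u (f' t x u)) - \<tau> *\<^sub>R h' u"

text \<open>The two vectors above are gradients of the Hamiltonians.\<close>

lemma grad_x_hamiltonian0_gradient:
  assumes b: "((\<lambda>(x, u). b t x u) has_derivative blinfun_apply (b' t x u)) (at (x, u) within UNIV \<times> U)"
    and f: "((\<lambda>(x, u). f t x u) has_derivative blinfun_apply (f' t x u)) (at (x, u) within UNIV \<times> U)"
    and u: "u \<in> U"
  shows "((\<lambda>x. hamiltonian0 b f t x p u) has_derivative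
    (\<lambda>k. grad_x_hamiltonian0 b' f' t x p u \<bullet> k)) (at x)"
proof -
  have e: "((\<lambda>x. (x, u)) has_derivative (\<lambda>k. (k, 0))) (at x)"
    by (auto intro!: derivative_eq_intros)
  have s: "(\<lambda>x. (x, u)) ` UNIV \<subseteq> UNIV \<times> U"
    using u by auto
  have b1: "((\<lambda>x. b t x u) has_derivative (\<lambda>k. b' t x u (k, 0))) (at x)"
    using has_derivative_in_compose[OF e has_derivative_subset[OF b s]] by simp
  have f1: "((\<lambda>x. f t x u) has_derivative (\<lambda>k. f' t x u (k, 0))) (at x)"
    using has_derivative_in_compose[OF e has_derivative_subset[OF f s]] by simp
  have a: "adjoint (blinfun_apply (part_x (b' t x u))) p \<bullet> k = p \<bullet> b' t x u (k, 0)" for k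
    using adjoint_works[of "blinfun_apply (part_x (b' t x u))" k p]
    by (simp add: inner_commute blinfun.bounded_linear_right bounded_linear.linear
        del: part_x_apply) (simp add: inner_commute)
  have "((\<lambda>x. p \<bullet> b t x u - f t x u) has_derivative (\<lambda>k. p \<bullet> b' t x u (k, 0) - f' t x u (k, 0))) (at x)"
    by (intro derivative_intros b1 f1)
  then show ?thesis
    by (simp add: hamiltonian0_def grad_x_hamiltonian0_def inner_diff_left a grad_vec_inner)
qed

lemma grad_u_hamiltonian_gradient:
  assumes b: "((\<lambda>(x, u). b t x u) has_derivative blinfun_apply (b' t x u)) (at (x, u) within UNIV \<times> U)"
    and f: "((\<lambda>(x, u). f t x u) has_derivative blinfun_apply (f' t x u)) (at (x, u) within UNIV \<times> U)"
    and h: "(h has_derivative (\<lambda>k. h' u \<bullet> k)) (at u within U)"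
  shows "((\<lambda>u. hamiltonian \<tau> b f h t x p u) has_derivative
    (\<lambda>k. grad_u_hamiltonian \<tau> b' f' h' t x p u \<bullet> k)) (at u within U)"
proof -
  have e: "((\<lambda>u. (x, u)) has_derivative (\<lambda>k. (0, k))) (at u within U)"
    by (auto intro!: derivative_eq_intros)
  have s: "(\<lambda>u. (x, u)) ` U \<subseteq> UNIV \<times> U"
    by auto
  have b1: "((\<lambda>u. b t x u) has_derivative (\<lambda>k. b' t x u (0, k))) (at u within U)"
    using has_derivative_in_compose[OF e has_derivative_subset[OF b s]] by simp
  have f1: "((\<lambda>u. f t x u) has_derivative (\<lambda>k. f' t x u (0, k))) (at u within U)"
    using has_derivative_in_compose[OF e has_derivative_subset[OF f s]] by simp
  have a: "adjoint (blinfun_apply (part_u (b' t x u))) p \<bullet> k = p \<bullet> b' t x u (0, k)" for k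
    using adjoint_works[of "blinfun_apply (part_u (b' t x u))" k p]
    by (simp add: inner_commute blinfun.bounded_linear_right bounded_linear.linear
        del: part_u_apply) (simp add: inner_commute)
  have "((\<lambda>u. p \<bullet> b t x u - f t x u - \<tau> * h u) has_derivative
      (\<lambda>k. p \<bullet> b' t x u (0, k) - f' t x u (0, k) - \<tau> * (h' u \<bullet> k))) (at u within U)"
    by (intro derivative_intros b1 f1 h)
  then show ?thesis
    by (simp add: hamiltonian_def hamiltonian0_def grad_u_hamiltonian_def inner_diff_left a
        grad_vec_inner)
qed

definition is_costate ::
    "real \<Rightarrow> (real \<Rightarrow> real^'d \<Rightarrow> real^'m \<Rightarrow> (((real^'d) \<times> (real^'m)) \<Rightarrow>\<^sub>L (real^'d)))
      \<Rightarrow> (real \<Rightarrow> real^'d \<Rightarrow> real^'m \<Rightarrow> (((real^'d) \<times> (real^'m)) \<Rightarrow>\<^sub>L real)) \<Rightarrow> (real^'d \<Rightarrow> real^'d)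
      \<Rightarrow> (real \<Rightarrow> real^'m) \<Rightarrow> (real \<Rightarrow> real^'d) \<Rightarrow> (real \<Rightarrow> real^'d) \<Rightarrow> bool"
  where
  "is_costate T b' f' g' u x p \<longleftrightarrow>
     p T = - g' (x T) \<and>
     (\<forall>t\<in>{0..T}. (p has_vector_derivative - grad_x_hamiltonian0 b' f' t (x t) (p t) (u t))
        (at t within {0..T}))"

text \<open>The adjoint equation is linear in \<open>p\<close>; its solution exists and is unique on \<open>{0..T}\<close>.
  (The \<open>x\<close>-derivatives of the coefficients are continuous in \<open>t\<close>, being locally uniform limits
  of difference quotients, so the solution is a classical one.)\<close>

definition costate ::
    "real \<Rightarrow> real^'d \<Rightarrow> (real \<Rightarrow> real^'d \<Rightarrow> real^'m \<Rightarrow> real^'d)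
      \<Rightarrow> (real \<Rightarrow> real^'d \<Rightarrow> real^'m \<Rightarrow> (((real^'d) \<times> (real^'m)) \<Rightarrow>\<^sub>L (real^'d)))
      \<Rightarrow> (real \<Rightarrow> real^'d \<Rightarrow> real^'m \<Rightarrow> (((real^'d) \<times> (real^'m)) \<Rightarrow>\<^sub>L real)) \<Rightarrow> (real^'d \<Rightarrow> real^'d)
      \<Rightarrow> (real \<Rightarrow> real^'m) \<Rightarrow> real \<Rightarrow> real^'d"
  where "costate T x0 b b' f' g' u = (SOME p. is_costate T b' f' g' u (state T x0 b u) p)"

definition bregman :: "(real^'m \<Rightarrow> real) \<Rightarrow> (real^'m \<Rightarrow> real^'m) \<Rightarrow> real^'m \<Rightarrow> real^'m \<Rightarrow> real"
  where "bregman h h' v u = h v - h u - h' u \<bullet> (v - u)"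

definition int_bregman ::
    "real \<Rightarrow> (real^'m \<Rightarrow> real) \<Rightarrow> (real^'m \<Rightarrow> real^'m) \<Rightarrow> (real \<Rightarrow> real^'m) \<Rightarrow> (real \<Rightarrow> real^'m) \<Rightarrow> real"
  where "int_bregman T h h' v u = integral {0..T} (\<lambda>t. bregman h h' (v t) (u t))"

definition dir_deriv :: "((real \<Rightarrow> real^'m) \<Rightarrow> real) \<Rightarrow> (real \<Rightarrow> real^'m) \<Rightarrow> (real \<Rightarrow> real^'m) \<Rightarrow> real"
  where "dir_deriv J u w = Lim (at_right 0) (\<lambda>\<epsilon>. (J (\<lambda>t. u t + \<epsilon> *\<^sub>R w t) - J u) / \<epsilon>)"

end

theory Submission
  imports Defs
begin

text \<open>Along the state-costate pair of \<open>u\<close>, the product rule for \<open>p \<bullet> (y - x)\<close>, where \<open>y\<close> is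
  the state of \<open>v\<close>, turns the terminal term of the cost difference into an integral, and the
  gradient inequalities for \<open>g\<close> and for the concave Hamiltonian give the bound with
  \<open>\<nabla>\<^sub>u H\<close>.

  Concavity of \<open>p \<bullet> b - f\<close> for every \<open>p\<close> forces \<open>b\<close> to be affine and \<open>f\<close> to be convex, so the
  state depends affinely on the control and the cost is convex along segments of controls. Its
  difference quotients are therefore monotone, and the adjoint bound keeps them bounded below, so
  the directional derivative exists. It is bounded by the cost difference because the quotient of
  the part without \<open>h\<close> is largest at the end of the segment, while the quotient of the
  \<open>h\<close>-part converges to the linear term of the Bregman divergence.\<close>

section \<open>Ordinary differential equations with Lipschitz right-hand side\<close>

text \<open>Rescaling by the weight \<open>exp (2 * M * t)\<close> makes the Picard operator a contraction on the
  whole interval, so no gluing of local solutions is needed.\<close>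

lemma lipschitz_ode_exists:
  fixes F :: "real \<Rightarrow> 'a::banach \<Rightarrow> 'a"
  assumes "0 \<le> T" "0 < M"
    and cont: "continuous_on ({0..T} \<times> UNIV) (\<lambda>(t, x). F t x)"
    and lip: "\<And>t x y. t \<in> {0..T} \<Longrightarrow> norm (F t x - F t y) \<le> M * norm (x - y)"
  obtains x where "x 0 = x0"
    "\<And>t. t \<in> {0..T} \<Longrightarrow> (x has_vector_derivative F t (x t)) (at t within {0..T})"
proof -
  \<comment> \<open>The rate is twice the Lipschitz constant, so the weighted Picard operator
    contracts by the factor \<open>M / L = 1 / 2\<close>.\<close>
  define L where "L = 2 * M"
  define G where "G z s = F s (exp (L * s) *\<^sub>R apply_bcontfun z s)" for z :: "real \<Rightarrow>\<^sub>C 'a" and s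
  \<comment> \<open>Here \<open>z\<close> stands for the rescaled unknown
    \<open>exp (- (L * t)) *\<^sub>R x t\<close>, so \<open>Q\<close> is the Picard operator in
    these coordinates.\<close>
  define Q where "Q z t = exp (- (L * t)) *\<^sub>R (x0 + integral {0..t} (G z))" for z t
  \<comment> \<open>Elements of the complete space of bounded continuous functions live on the whole
    line, so \<open>Q z\<close> is extended constantly outside \<open>{0..T}\<close>.\<close>
  define P where "P z = Bcontfun (ext_cont (Q z) 0 T)" for z
  have G_cont: "continuous_on {0..T} (G z)" for z
    unfolding G_def
    by (rule continuous_on_compose2[OF cont, where f="\<lambda>s. (s, exp (L * s) *\<^sub>R apply_bcontfun z s)", simplified])
      (auto intro!: continuous_intros)
  have Q_cont: "continuous_on {0..T} (Q z)" for z
    unfolding Q_def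
    by (intro continuous_intros indefinite_integral_continuous_1 integrable_continuous_interval G_cont)
  have P_apply: "apply_bcontfun (P z) t = Q z (clamp 0 T t)" for z t
  proof -
    have "ext_cont (Q z) 0 T \<in> bcontfun"
    proof (unfold bcontfun_def, safe)
      show "continuous_on UNIV (ext_cont (Q z) 0 T)"
        unfolding ext_cont_def using Q_cont[of z] by (intro clamp_continuous_on) simp
      have "bounded (Q z ` {0..T})"
        by (intro compact_imp_bounded compact_continuous_image Q_cont compact_Icc)
      then show "bounded (range (ext_cont (Q z) 0 T))"
        unfolding ext_cont_def by (intro clamp_bounded) simp
    qed
    then show ?thesis by (simp add: P_def Bcontfun_inverse ext_cont_def)
  qed
  have contr: "dist (P z) (P w) \<le> 1/2 * dist z w" for z w
  proof (rule dist_bound)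
    fix t
    define c where "c = clamp 0 T t"
    have c: "0 \<le> c" "c \<le> T"
      using clamp_in_interval[of "0::real" T t] \<open>0 \<le> T\<close> by (auto simp: c_def)
    have int: "G y integrable_on {0..c}" for y
      using c by (intro integrable_continuous_interval continuous_on_subset[OF G_cont]) auto
    have e_int: "((\<lambda>s. M * dist z w * exp (L * s)) has_integral
        M * dist z w / L * exp (L * c) - M * dist z w / L * exp (L * 0)) {0..c}"
      using c \<open>0 < M\<close>
      by (intro fundamental_theorem_of_calculus)
        (auto intro!: derivative_eq_intros simp: L_def has_real_derivative_iff_has_vector_derivative[symmetric])
    have "dist (Q z c) (Q w c) = exp (- (L * c)) * norm (integral {0..c} (\<lambda>s. G z s - G w s))"
      by (simp add: Q_def dist_norm integral_diff[OF int int] flip: scaleR_diff_right)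
    also have "norm (integral {0..c} (\<lambda>s. G z s - G w s)) \<le> integral {0..c} (\<lambda>s. M * dist z w * exp (L * s))"
    proof (rule integral_norm_bound_integral)
      show "(\<lambda>s. G z s - G w s) integrable_on {0..c}" by (intro integrable_diff int)
      show "(\<lambda>s. M * dist z w * exp (L * s)) integrable_on {0..c}" using e_int by blast
      fix s assume s: "s \<in> {0..c}"
      have "norm (G z s - G w s) \<le> M * (exp (L * s) * dist (apply_bcontfun z s) (apply_bcontfun w s))"
        using lip[of s "exp (L * s) *\<^sub>R apply_bcontfun z s" "exp (L * s) *\<^sub>R apply_bcontfun w s"] s c
        by (simp add: G_def dist_norm flip: scaleR_diff_right)
      also have "\<dots> \<le> M * (exp (L * s) * dist z w)"
        using \<open>0 < M\<close> by (intro mult_left_mono dist_bounded) auto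
      finally show "norm (G z s - G w s) \<le> M * dist z w * exp (L * s)" by (simp add: ac_simps)
    qed
    also have "\<dots> = dist z w / 2 * (exp (L * c) - 1)"
      using integral_unique[OF e_int] \<open>0 < M\<close> by (simp add: L_def field_simps)
    also have "exp (- (L * c)) * \<dots> = dist z w / 2 * (1 - exp (- (L * c)))"
      by (simp add: algebra_simps exp_minus)
    also have "\<dots> \<le> dist z w / 2 * 1"
      by (intro mult_left_mono) auto
    finally show "dist (apply_bcontfun (P z) t) (apply_bcontfun (P w) t) \<le> 1/2 * dist z w"
      by (simp add: P_apply c_def mult_left_mono)
  qed
  obtain z where z: "P z = z"
    using banach_fix_type[of "1/2" P] contr by auto
  define x where "x t = exp (L * t) *\<^sub>R apply_bcontfun z t" for t
  \<comment> \<open>On \<open>{0..T}\<close> clamping is the identity; undoing the weight turns the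
    fixed-point equation into the integral equation for \<open>x\<close>.\<close>
  have x: "x t = x0 + integral {0..t} (\<lambda>s. F s (x s))" if "t \<in> {0..T}" for t
  proof -
    have "apply_bcontfun z t = Q z t"
      using P_apply[of z t] z that by simp
    then show ?thesis
      by (simp add: x_def Q_def G_def[abs_def] exp_minus)
  qed
  have "continuous_on {0..T} (\<lambda>s. F s (x s))"
    using G_cont[of z] by (simp add: G_def x_def)
  note der = integral_has_vector_derivative[OF this]
  show thesis
  proof
    show "x 0 = x0" using x[of 0] \<open>0 \<le> T\<close> by simp
    fix t assume t: "t \<in> {0..T}"
    have "((\<lambda>t. x0 + integral {0..t} (\<lambda>s. F s (x s))) has_vector_derivative F t (x t)) (at t within {0..T})"
      by (rule derivative_eq_intros der[OF t] refl)+ simp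
    then show "(x has_vector_derivative F t (x t)) (at t within {0..T})"
      by (rule has_vector_derivative_transform[rotated 2]) (use t x in auto)
  qed
qed

text \<open>Time reversal \<open>t \<mapsto> T - t\<close> turns the terminal condition into an
  initial one and \<open>F\<close> into \<open>- F (T - t)\<close>. The adjoint equation is solved
  this way.\<close>

lemma lipschitz_ode_exists_terminal:
  fixes F :: "real \<Rightarrow> 'a::banach \<Rightarrow> 'a"
  assumes "0 \<le> T" "0 < M"
    and cont: "continuous_on ({0..T} \<times> UNIV) (\<lambda>(t, x). F t x)"
    and lip: "\<And>t x y. t \<in> {0..T} \<Longrightarrow> norm (F t x - F t y) \<le> M * norm (x - y)"
  obtains x where "x T = xT"
    "\<And>t. t \<in> {0..T} \<Longrightarrow> (x has_vector_derivative F t (x t)) (at t within {0..T})"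
proof -
  have "continuous_on ({0..T} \<times> UNIV) (\<lambda>z. (\<lambda>(t, x). F t x) (T - fst z, snd z))"
    by (rule continuous_on_compose2[OF cont]) (auto intro!: continuous_intros)
  from continuous_on_minus[OF this]
  have "continuous_on ({0..T} \<times> UNIV) (\<lambda>(t, x). - F (T - t) x)"
    by (simp add: case_prod_unfold)
  moreover have "norm (- F (T - t) x - - F (T - t) y) \<le> M * norm (x - y)" if "t \<in> {0..T}" for t x y
    using lip[of "T - t" y x] that by (simp add: norm_minus_commute)
  ultimately obtain y where y: "y 0 = xT"
    "\<And>t. t \<in> {0..T} \<Longrightarrow> (y has_vector_derivative - F (T - t) (y t)) (at t within {0..T})"
    using lipschitz_ode_exists[of T M "\<lambda>t x. - F (T - t) x" xT] assms(1,2) by blast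
  show thesis
  proof (rule that[of "\<lambda>t. y (T - t)"])
    show "y (T - T) = xT" using y by simp
    fix t assume t: "t \<in> {0..T}"
    have im: "(\<lambda>t. T - t) ` {0..T} = {0..T}" by simp
    have "((\<lambda>t. T - t) has_vector_derivative -1) (at t within {0..T})"
      by (auto intro!: derivative_eq_intros)
    from vector_diff_chain_within[OF this, of y "- F t (y (T - t))"] y(2)[of "T - t"] t
    show "((\<lambda>t. y (T - t)) has_vector_derivative F t (y (T - t))) (at t within {0..T})"
      by (simp add: o_def im)
  qed
qed

text \<open>A Gronwall argument in energy form: the squared distance with weight
  \<open>exp (- (2 * M * t))\<close> is nonincreasing and starts at zero. Squaring avoids
  differentiating the norm at the origin.\<close>

lemma lipschitz_ode_unique:
  fixes x y :: "real \<Rightarrow> 'a::real_inner"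
  assumes lip: "\<And>t x y. t \<in> {0..T} \<Longrightarrow> norm (F t x - F t y) \<le> M * norm (x - y)"
    and x: "\<And>t. t \<in> {0..T} \<Longrightarrow> (x has_vector_derivative F t (x t)) (at t within {0..T})"
    and y: "\<And>t. t \<in> {0..T} \<Longrightarrow> (y has_vector_derivative F t (y t)) (at t within {0..T})"
    and "x 0 = y 0" and t: "t \<in> {0..T}"
  shows "x t = y t"
proof -
  define d where "d t = x t - y t" for t
  define \<phi> where "\<phi> t = exp (- (2 * M * t)) * (d t \<bullet> d t)" for t
  have d: "(d has_vector_derivative F s (x s) - F s (y s)) (at s within {0..T})" if "s \<in> {0..T}" for s
    unfolding d_def using that by (intro derivative_intros x y)
  have \<phi>: "(\<phi> has_real_derivative
      exp (- (2 * M * s)) * (2 * (d s \<bullet> (F s (x s) - F s (y s))) - 2 * M * (d s \<bullet> d s))) (at s within {0..T})"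
    if "s \<in> {0..T}" for s
  proof -
    note d' = d[OF that, unfolded has_vector_derivative_def]
    have "((\<lambda>t. d t \<bullet> d t) has_real_derivative 2 * (d s \<bullet> (F s (x s) - F s (y s)))) (at s within {0..T})"
      unfolding has_field_derivative_def
      by (rule has_derivative_eq_rhs[OF has_derivative_inner[OF d' d']])
        (auto simp: inner_commute)
    then show ?thesis
      unfolding \<phi>_def by (auto intro!: derivative_eq_intros simp: algebra_simps)
  qed
  have "\<phi> 0 \<ge> \<phi> t"
  proof (rule DERIV_nonpos_imp_decreasing_open[of 0 t \<phi>])
    show "0 \<le> t" using t by simp
    have "continuous_on {0..T} \<phi>" using \<phi> by (meson DERIV_continuous continuous_on_eq_continuous_within)
    then show "continuous_on {0..t} \<phi>" using t by (auto elim: continuous_on_subset)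
    fix s assume s: "0 < s" "s < t"
    \<comment> \<open>At interior points the derivative within \<open>{0..T}\<close> is the
      two-sided derivative that the monotonicity criterion asks for.\<close>
    then have sT: "s \<in> {0..T}" "s \<in> interior {0..T}" using t by auto
    have "d s \<bullet> (F s (x s) - F s (y s)) \<le> norm (d s) * norm (F s (x s) - F s (y s))"
      by (rule norm_cauchy_schwarz)
    also have "\<dots> \<le> norm (d s) * (M * norm (d s))"
      using lip[OF sT(1)] by (intro mult_left_mono) (auto simp: d_def)
    also have "\<dots> = M * (d s \<bullet> d s)"
      by (simp add: dot_square_norm power2_eq_square)
    finally have "exp (- (2 * M * s)) * (2 * (d s \<bullet> (F s (x s) - F s (y s))) - 2 * M * (d s \<bullet> d s)) \<le> 0"
      by (intro mult_nonneg_nonpos) auto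
    then show "\<exists>y. DERIV \<phi> s :> y \<and> y \<le> 0"
      using \<phi>[OF sT(1)] unfolding at_within_interior[OF sT(2)] by blast
  qed
  then have "d t \<bullet> d t \<le> 0" using \<open>x 0 = y 0\<close> by (simp add: \<phi>_def d_def mult_le_0_iff)
  then have "d t \<bullet> d t = 0" using inner_ge_zero[of "d t"] by linarith
  then show ?thesis by (simp add: d_def)
qed

section \<open>Directional difference quotients\<close>

text \<open>Only the segment from \<open>z\<close> to \<open>z + w\<close> matters, and convexity
  keeps it in \<open>S\<close>. Hence the limit makes sense even where \<open>S\<close> has empty
  interior, as \<open>U\<close> may.\<close>

lemma has_derivative_imp_dir_quotient:
  fixes \<phi> :: "'a::real_normed_vector \<Rightarrow> 'b::real_normed_vector"
  assumes D: "(\<phi> has_derivative D) (at z within S)" and S: "convex S" "z \<in> S" "z + w \<in> S"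
  shows "((\<lambda>s. (\<phi> (z + s *\<^sub>R w) - \<phi> z) /\<^sub>R s) \<longlongrightarrow> D w) (at_right 0)"
proof -
  have seg: "z + s *\<^sub>R w \<in> S" if "s \<in> {0..1}" for s
    using convexD_alt[OF S, of s] that by (simp add: algebra_simps)
  have "((\<lambda>s. z + s *\<^sub>R w) has_derivative (\<lambda>s. s *\<^sub>R w)) (at 0 within {0..1})"
    by (auto intro!: derivative_eq_intros)
  then have "((\<lambda>s. \<phi> (z + s *\<^sub>R w)) has_derivative (\<lambda>s. D (s *\<^sub>R w))) (at 0 within {0..1})"
    using has_derivative_in_compose[of "\<lambda>s. z + s *\<^sub>R w" "\<lambda>s. s *\<^sub>R w" 0 "{0..1}" \<phi> D]
      has_derivative_subset[OF D, of "(\<lambda>s. z + s *\<^sub>R w) ` {0..1}"] seg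
    by (simp add: image_subset_iff)
  then have "((\<lambda>s. \<phi> (z + s *\<^sub>R w)) has_vector_derivative D w) (at 0 within {0..1})"
    using linear_scale[OF has_derivative_linear[OF D]] by (simp add: has_vector_derivative_def)
  then have lim: "((\<lambda>s. (\<phi> (z + s *\<^sub>R w) - \<phi> z - s *\<^sub>R D w) /\<^sub>R norm s) \<longlongrightarrow> 0) (at_right 0)"
    by (simp only: has_vector_derivative_def has_derivative_at_within at_within_Icc_at_right[OF zero_less_one]
        diff_zero scaleR_zero_left add_0_right)
  have "((\<lambda>s. (\<phi> (z + s *\<^sub>R w) - \<phi> z - s *\<^sub>R D w) /\<^sub>R norm s + D w) \<longlongrightarrow> D w) (at_right 0)"
    using tendsto_add[OF lim tendsto_const[of "D w"]] by simp
  then show ?thesis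
  proof (rule Lim_transform_eventually)
    show "\<forall>\<^sub>F s in at_right 0. (\<phi> (z + s *\<^sub>R w) - \<phi> z - s *\<^sub>R D w) /\<^sub>R norm s + D w
        = (\<phi> (z + s *\<^sub>R w) - \<phi> z) /\<^sub>R s"
      by (rule eventually_at_rightI[of 0 1]) (auto simp: scaleR_diff_right)
  qed
qed

text \<open>By convexity every difference quotient along the segment is at most
  \<open>\<phi> y - \<phi> z\<close>; let the step tend to zero from the right.\<close>

lemma convex_on_gradient_ineq:
  fixes \<phi> :: "'a::real_normed_vector \<Rightarrow> real"
  assumes \<phi>: "convex_on S \<phi>" and D: "(\<phi> has_derivative D) (at z within S)"
    and S: "z \<in> S" "y \<in> S"
  shows "D (y - z) \<le> \<phi> y - \<phi> z"
proof -
  have "convex S" using \<phi> convex_on_imp_convex by blast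
  have "((\<lambda>s. (\<phi> (z + s *\<^sub>R (y - z)) - \<phi> z) /\<^sub>R s) \<longlongrightarrow> D (y - z)) (at_right 0)"
    using has_derivative_imp_dir_quotient[OF D \<open>convex S\<close>] S by simp
  moreover have "\<forall>\<^sub>F s in at_right 0. (\<phi> (z + s *\<^sub>R (y - z)) - \<phi> z) /\<^sub>R s \<le> \<phi> y - \<phi> z"
  proof (rule eventually_at_rightI[of 0 1])
    fix s :: real assume s: "s \<in> {0<..<1}"
    then have "\<phi> (z + s *\<^sub>R (y - z)) \<le> (1 - s) * \<phi> z + s * \<phi> y"
      using convex_onD[OF \<phi>, of s z y] S by (simp add: algebra_simps)
    then show "(\<phi> (z + s *\<^sub>R (y - z)) - \<phi> z) /\<^sub>R s \<le> \<phi> y - \<phi> z"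
      using s by (simp add: field_simps)
  qed simp
  ultimately show ?thesis by (rule tendsto_upperbound) simp
qed

text \<open>The limit is the infimum of \<open>q\<close> on \<open>{a<..b}\<close>. This yields
  existence of the directional derivative of the cost without computing it.\<close>

lemma tendsto_at_right_mono_bounded:
  fixes q :: "real \<Rightarrow> real"
  assumes "a < b" and mono: "\<And>s t. a < s \<Longrightarrow> s \<le> t \<Longrightarrow> t \<le> b \<Longrightarrow> q s \<le> q t"
    and bound: "\<And>s. a < s \<Longrightarrow> s \<le> b \<Longrightarrow> c \<le> q s"
  obtains L where "(q \<longlongrightarrow> L) (at_right a)"
proof
  have bdd: "bdd_below (q ` {a<..b})" using bound by (auto intro!: bdd_belowI)
  show "(q \<longlongrightarrow> Inf (q ` {a<..b})) (at_right a)"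
  proof (rule order_tendstoI)
    fix y assume "y < Inf (q ` {a<..b})"
    then show "\<forall>\<^sub>F s in at_right a. y < q s"
      using \<open>a < b\<close> cInf_lower[OF _ bdd] by (intro eventually_at_rightI[of a b]) fastforce+
  next
    fix y assume "Inf (q ` {a<..b}) < y"
    then obtain t where t: "a < t" "t \<le> b" "q t < y"
      using cInf_lessD[of "q ` {a<..b}" y] \<open>a < b\<close> by auto
    show "\<forall>\<^sub>F s in at_right a. q s < y"
    proof (rule eventually_at_rightI[of a t])
      show "q s < y" if "s \<in> {a<..<t}" for s
        using mono[of s t] that t by auto
    qed (use t in auto)
  qed
qed

text \<open>Dominated convergence speaks of sequences, so one-sided limits are sampled at the steps
  \<open>1 / real (Suc n)\<close>, which stay in \<open>{0<..1}\<close>.\<close>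

lemma filterlim_inverse_Suc_at_right: "filterlim (\<lambda>n. 1 / real (Suc n)) (at_right 0) sequentially"
  unfolding filterlim_at
  using LIMSEQ_inverse_real_of_nat by (auto simp: inverse_eq_divide intro!: always_eventually)

section \<open>Coefficients and controls\<close>

lemma lipschitz_coeff_continuous:
  assumes "lipschitz_coeff T U M \<phi>"
    and "continuous_on S t" "continuous_on S x" "continuous_on S u"
    and "\<And>z. z \<in> S \<Longrightarrow> t z \<in> {0..T} \<and> u z \<in> U"
  shows "continuous_on S (\<lambda>z. \<phi> (t z) (x z) (u z))"
proof -
  have "continuous_on ({0..T} \<times> UNIV \<times> U) (\<lambda>(t, x, u). \<phi> t x u)"
    using assms(1) by (simp add: lipschitz_coeff_def)
  then have "continuous_on S (\<lambda>z. (\<lambda>(t, x, u). \<phi> t x u) (t z, x z, u z))"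
    by (rule continuous_on_compose2) (use assms in \<open>auto intro!: continuous_intros\<close>)
  then show ?thesis by simp
qed

lemma lipschitz_coeffD:
  assumes "lipschitz_coeff T U M \<phi>" "t \<in> {0..T}" "u \<in> U" "u' \<in> U"
  shows "norm (\<phi> t x u - \<phi> t x' u') \<le> M * (norm (x - x') + norm (u - u'))"
  using assms by (simp add: lipschitz_coeff_def)

lemma smooth_coeff_has_derivative:
  assumes "smooth_coeff T U M Muu \<phi> \<phi>' \<phi>''" "t \<in> {0..T}" "u \<in> U"
  shows "((\<lambda>(x, u). \<phi> t x u) has_derivative blinfun_apply (\<phi>' t x u)) (at (x, u) within UNIV \<times> U)"
  using assms by (simp add: smooth_coeff_def)

lemma smooth_coeff_dir_quotient:
  assumes "smooth_coeff T U M Muu \<phi> \<phi>' \<phi>''" "convex U" "t \<in> {0..T}" "u \<in> U" "u + w \<in> U"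
  shows "((\<lambda>s. (\<phi> t (x + s *\<^sub>R k) (u + s *\<^sub>R w) - \<phi> t x u) /\<^sub>R s) \<longlongrightarrow> \<phi>' t x u (k, w)) (at_right 0)"
  using has_derivative_imp_dir_quotient[OF smooth_coeff_has_derivative[OF assms(1,3,4), of x], of "(k, w)"] assms
  by (simp add: convex_Times)

text \<open>The Lipschitz bound on difference quotients survives the limit. The direction must
  satisfy \<open>u + w \<in> U\<close>, because \<open>\<phi>\<close> does not control the chosen
  \<open>\<phi>'\<close> in directions leaving the affine hull of \<open>U\<close>.\<close>

lemma smooth_coeff_derivative_bound:
  assumes "lipschitz_coeff T U M \<phi>" "smooth_coeff T U M Muu \<phi> \<phi>' \<phi>''" "convex U"
    "t \<in> {0..T}" "u \<in> U" "u + w \<in> U"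
  shows "norm (\<phi>' t x u (k, w)) \<le> M * (norm k + norm w)"
proof (rule tendsto_upperbound[OF tendsto_norm[OF smooth_coeff_dir_quotient[OF assms(2-)]]])
  show "\<forall>\<^sub>F s in at_right 0. norm ((\<phi> t (x + s *\<^sub>R k) (u + s *\<^sub>R w) - \<phi> t x u) /\<^sub>R s) \<le> M * (norm k + norm w)"
  proof (rule eventually_at_rightI[of 0 1])
    fix s :: real assume s: "s \<in> {0<..<1}"
    have "u + s *\<^sub>R w \<in> U"
      using convexD_alt[OF \<open>convex U\<close> \<open>u \<in> U\<close> \<open>u + w \<in> U\<close>, of s] s by (simp add: algebra_simps)
    from lipschitz_coeffD[OF assms(1,4) this \<open>u \<in> U\<close>, of "x + s *\<^sub>R k" x]
    have "norm (\<phi> t (x + s *\<^sub>R k) (u + s *\<^sub>R w) - \<phi> t x u) \<le> s * (M * (norm k + norm w))"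
      using s by (simp add: algebra_simps)
    then show "norm ((\<phi> t (x + s *\<^sub>R k) (u + s *\<^sub>R w) - \<phi> t x u) /\<^sub>R s) \<le> M * (norm k + norm w)"
      using s by (simp add: inverse_eq_divide pos_divide_le_eq mult.commute)
  qed simp
qed simp

text \<open>The \<open>x\<close>-derivative is \<open>M\<close>-Lipschitz, so it varies by at most
  \<open>M * norm k\<close> on the ball of radius \<open>norm k\<close>, and the mean value
  inequality applies. The remainder is uniform in \<open>t\<close>, \<open>x\<close> and
  \<open>u\<close>.\<close>

lemma smooth_coeff_linearization:
  assumes \<phi>: "smooth_coeff T U M Muu \<phi> \<phi>' \<phi>''" and t: "t \<in> {0..T}" and u: "u \<in> U" and "0 \<le> M"
  shows "norm (\<phi> t (x + k) u - \<phi> t x u - \<phi>' t x u (k, 0)) \<le> M * (norm k)\<^sup>2"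
proof -
  have D: "((\<lambda>y. \<phi> t y u) has_derivative blinfun_apply (part_x (\<phi>' t y u))) (at y)" for y
  proof -
    have e: "((\<lambda>y. (y, u)) has_derivative (\<lambda>k. (k, 0))) (at y)"
      by (auto intro!: derivative_eq_intros)
    have s: "range (\<lambda>y. (y, u)) \<subseteq> UNIV \<times> U"
      using u by auto
    show ?thesis
      using has_derivative_in_compose[OF e has_derivative_subset[OF smooth_coeff_has_derivative[OF \<phi> t u] s]]
      by (simp add: part_x_apply[abs_def])
  qed
  have "norm (\<phi> t (x + k) u - \<phi> t x u - part_x (\<phi>' t x u) (x + k - x)) \<le> norm (x + k - x) * (M * norm k)"
  proof (rule differentiable_bound_linearization[where S="cball x (norm k)" and f="\<lambda>y. \<phi> t y u"
        and f'="\<lambda>y. blinfun_apply (part_x (\<phi>' t y u))"])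
    fix s :: real assume "s \<in> {0..1}"
    then show "x + s *\<^sub>R (x + k - x) \<in> cball x (norm k)"
      by (simp add: dist_norm mult_left_le_one_le)
  next
    fix y assume "y \<in> cball x (norm k)"
    then show "((\<lambda>y. \<phi> t y u) has_derivative blinfun_apply (part_x (\<phi>' t y u))) (at y within cball x (norm k))"
      using D has_derivative_at_withinI by blast
  next
    fix y assume y: "y \<in> cball x (norm k)"
    have "norm (part_x (\<phi>' t y u) - part_x (\<phi>' t x u)) \<le> M * (norm (y - x) + norm (u - u))"
      using \<phi> t u unfolding smooth_coeff_def by blast
    also have "\<dots> \<le> M * norm k"
      using y \<open>0 \<le> M\<close> by (simp add: dist_norm norm_minus_commute mult_left_mono)
    also have "norm (part_x (\<phi>' t y u) - part_x (\<phi>' t x u))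
        = onorm (blinfun_apply (part_x (\<phi>' t y u)) - blinfun_apply (part_x (\<phi>' t x u)))"
      by (simp only: norm_blinfun.rep_eq minus_blinfun.rep_eq fun_diff_def)
    finally show "onorm (blinfun_apply (part_x (\<phi>' t y u)) - blinfun_apply (part_x (\<phi>' t x u))) \<le> M * norm k" .
  qed simp
  then show ?thesis by (simp add: power2_eq_square ac_simps)
qed

text \<open>Difference quotients in \<open>x\<close> inherit continuity in \<open>t\<close> from
  \<open>\<phi>\<close>, and the quadratic remainder makes their convergence uniform on
  \<open>{0..T}\<close>; hence the limit is continuous.\<close>

lemma smooth_coeff_part_x_continuous:
  assumes lip: "lipschitz_coeff T U M \<phi>" and \<phi>: "smooth_coeff T U M Muu \<phi> \<phi>' \<phi>''" and "0 \<le> M"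
    and x: "continuous_on {0..T} x" and u: "continuous_on {0..T} u" "u ` {0..T} \<subseteq> U"
  shows "continuous_on {0..T} (\<lambda>t. \<phi>' t (x t) (u t) (k, 0))"
proof (rule uniform_limit_theorem)
  show "\<forall>\<^sub>F s in at_right 0. continuous_on {0..T} (\<lambda>t. (\<phi> t (x t + s *\<^sub>R k) (u t) - \<phi> t (x t) (u t)) /\<^sub>R s)"
    using x u
    by (intro always_eventually allI continuous_intros lipschitz_coeff_continuous[OF lip]) auto
  show "uniform_limit {0..T} (\<lambda>s t. (\<phi> t (x t + s *\<^sub>R k) (u t) - \<phi> t (x t) (u t)) /\<^sub>R s)
      (\<lambda>t. \<phi>' t (x t) (u t) (k, 0)) (at_right 0)"
  proof (rule uniform_limitI)
    fix e :: real assume "0 < e"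
    \<comment> \<open>The summand 1 keeps \<open>c\<close> positive when \<open>k = 0\<close>, so
      that \<open>e / c\<close> is a legitimate step bound.\<close>
    define c where "c = M * (norm k)\<^sup>2 + 1"
    have "c > 0" using \<open>0 \<le> M\<close> by (simp add: c_def add_nonneg_pos)
    show "\<forall>\<^sub>F s in at_right 0. \<forall>t\<in>{0..T}.
        dist ((\<phi> t (x t + s *\<^sub>R k) (u t) - \<phi> t (x t) (u t)) /\<^sub>R s) (\<phi>' t (x t) (u t) (k, 0)) < e"
    proof (rule eventually_at_rightI[of 0 "e / c"])
      show "0 < e / c" using \<open>0 < e\<close> \<open>c > 0\<close> by simp
      fix s assume s: "s \<in> {0<..<e / c}"
      show "\<forall>t\<in>{0..T}.
        dist ((\<phi> t (x t + s *\<^sub>R k) (u t) - \<phi> t (x t) (u t)) /\<^sub>R s) (\<phi>' t (x t) (u t) (k, 0)) < e"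
      proof
        fix t assume t: "t \<in> {0..T}"
        let ?r = "\<phi> t (x t + s *\<^sub>R k) (u t) - \<phi> t (x t) (u t) - s *\<^sub>R \<phi>' t (x t) (u t) (k, 0)"
        have "blinfun_apply (\<phi>' t (x t) (u t)) (s *\<^sub>R k, 0) = s *\<^sub>R \<phi>' t (x t) (u t) (k, 0)"
          using blinfun.scaleR_right[of "\<phi>' t (x t) (u t)" s "(k, 0)"] by simp
        then have r: "norm ?r \<le> M * (norm (s *\<^sub>R k))\<^sup>2"
          using smooth_coeff_linearization[OF \<phi> t _ \<open>0 \<le> M\<close>, of "u t" "x t" "s *\<^sub>R k"] u(2) t
          by (simp only: image_subset_iff)
        have "(\<phi> t (x t + s *\<^sub>R k) (u t) - \<phi> t (x t) (u t)) /\<^sub>R s - \<phi>' t (x t) (u t) (k, 0) = ?r /\<^sub>R s"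
          using s by (simp add: scaleR_diff_right)
        then have "dist ((\<phi> t (x t + s *\<^sub>R k) (u t) - \<phi> t (x t) (u t)) /\<^sub>R s) (\<phi>' t (x t) (u t) (k, 0)) = norm ?r / s"
          using s by (simp add: dist_norm divide_inverse_commute)
        also have "\<dots> \<le> s * (M * (norm k)\<^sup>2)"
          using r s by (simp add: divide_le_eq power_mult_distrib power2_eq_square ac_simps)
        also have "\<dots> \<le> s * c" using s by (intro mult_left_mono) (auto simp: c_def)
        also have "\<dots> < e" using s \<open>c > 0\<close> by (simp add: field_simps)
        finally show "dist ((\<phi> t (x t + s *\<^sub>R k) (u t) - \<phi> t (x t) (u t)) /\<^sub>R s) (\<phi>' t (x t) (u t) (k, 0)) < e" .
      qed
    qed
  qed
qed simp

lemma adjoint_blinfun_inner: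
  fixes A :: "'a::euclidean_space \<Rightarrow>\<^sub>L 'b::euclidean_space"
  shows "adjoint (blinfun_apply A) p \<bullet> k = p \<bullet> blinfun_apply A k"
  using adjoint_works[of "blinfun_apply A" k p]
  by (simp add: inner_commute blinfun.bounded_linear_right bounded_linear.linear)

lemma grad_x_hamiltonian0_inner:
  "grad_x_hamiltonian0 b' f' t x p u \<bullet> k = p \<bullet> b' t x u (k, 0) - f' t x u (k, 0)"
  by (simp add: grad_x_hamiltonian0_def inner_diff_left adjoint_blinfun_inner grad_vec_inner)

lemma grad_u_hamiltonian_inner:
  "grad_u_hamiltonian \<tau> b' f' h' t x p u \<bullet> k
     = p \<bullet> b' t x u (0, k) - f' t x u (0, k) - \<tau> * (h' u \<bullet> k)"
  by (simp add: grad_u_hamiltonian_def inner_diff_left adjoint_blinfun_inner grad_vec_inner)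

lemma controls_convex_combination:
  assumes "convex U" "u \<in> controls T U" "v \<in> controls T U" "0 \<le> s" "s \<le> 1"
  shows "(\<lambda>t. u t + s *\<^sub>R (v t - u t)) \<in> controls T U"
proof -
  have "u t + s *\<^sub>R (v t - u t) \<in> U" if "t \<in> {0..T}" for t
    using convexD_alt[OF \<open>convex U\<close>, of "u t" "v t" s] assms that
    by (auto simp: controls_def algebra_simps image_subset_iff)
  then show ?thesis
    using assms by (auto simp: controls_def intro!: continuous_intros)
qed

section \<open>The control problem\<close>

locale concave_hamiltonian_problem =
  fixes T M Mbuu Mfuu :: real
    and x0 :: "real^'d"
    and U :: "(real^'m) set"
    and b :: "real \<Rightarrow> real^'d \<Rightarrow> real^'m \<Rightarrow> real^'d"
    and b' :: "real \<Rightarrow> real^'d \<Rightarrow> real^'m \<Rightarrow> (((real^'d) \<times> (real^'m)) \<Rightarrow>\<^sub>L (real^'d))"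
    and b'' :: "real \<Rightarrow> real^'d \<Rightarrow> real^'m \<Rightarrow> (((real^'d) \<times> (real^'m)) \<Rightarrow>\<^sub>L (((real^'d) \<times> (real^'m)) \<Rightarrow>\<^sub>L (real^'d)))"
    and f :: "real \<Rightarrow> real^'d \<Rightarrow> real^'m \<Rightarrow> real"
    and f' :: "real \<Rightarrow> real^'d \<Rightarrow> real^'m \<Rightarrow> (((real^'d) \<times> (real^'m)) \<Rightarrow>\<^sub>L real)"
    and f'' :: "real \<Rightarrow> real^'d \<Rightarrow> real^'m \<Rightarrow> (((real^'d) \<times> (real^'m)) \<Rightarrow>\<^sub>L (((real^'d) \<times> (real^'m)) \<Rightarrow>\<^sub>L real))"
    and g :: "real^'d \<Rightarrow> real" and g' :: "real^'d \<Rightarrow> real^'d"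
    and h :: "real^'m \<Rightarrow> real" and h' :: "real^'m \<Rightarrow> real^'m"
  assumes T_pos: "0 < T" and M_pos: "0 < M" and U_convex: "convex U"
    and b_lipschitz: "lipschitz_coeff T U M b" and f_lipschitz: "lipschitz_coeff T U M f"
    and b_smooth: "smooth_coeff T U M Mbuu b b' b''" and f_smooth: "smooth_coeff T U M Mfuu f f' f''"
    and g_derivative: "\<And>x. (g has_derivative (\<lambda>k. g' x \<bullet> k)) (at x)"
    and h_convex: "convex_on U h"
    and h_derivative: "\<And>w. w \<in> U \<Longrightarrow> (h has_derivative (\<lambda>k. h' w \<bullet> k)) (at w within U)"
    and h'_continuous: "continuous_on U h'"
    and g_convex: "convex_on UNIV g"
    and H_concave: "\<And>t p. t \<in> {0..T} \<Longrightarrow> concave_on (UNIV \<times> U) (\<lambda>(x, w). hamiltonian0 b f t x p w)"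
begin

section \<open>States and costates of a control\<close>

lemma controlsD:
  assumes "u \<in> controls T U"
  shows "continuous_on {0..T} u" "u ` {0..T} \<subseteq> U" "t \<in> {0..T} \<Longrightarrow> u t \<in> U"
  using assms by (auto simp: controls_def)

text \<open>Existence for the Lipschitz equation turns the Hilbert choice behind
  \<open>state\<close> into a genuine solution.\<close>

lemma is_state_state:
  assumes u: "u \<in> controls T U"
  shows "is_state T x0 b u (state T x0 b u)"
proof -
  have "continuous_on ({0..T} \<times> UNIV) (\<lambda>z. b (fst z) (snd z) (u (fst z)))"
    using controlsD[OF u]
    by (intro lipschitz_coeff_continuous[OF b_lipschitz] continuous_intros
        continuous_on_compose2[OF controlsD(1)[OF u]]) auto
  then have cont: "continuous_on ({0..T} \<times> UNIV) (\<lambda>(t, x). b t x (u t))"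
    by (simp add: case_prod_unfold)
  have lip: "norm (b t x (u t) - b t y (u t)) \<le> M * norm (x - y)" if "t \<in> {0..T}" for t x y
    using lipschitz_coeffD[OF b_lipschitz that controlsD(3)[OF u that] controlsD(3)[OF u that]]
    by simp
  obtain x where "x 0 = x0"
    "\<And>t. t \<in> {0..T} \<Longrightarrow> (x has_vector_derivative b t (x t) (u t)) (at t within {0..T})"
    by (rule lipschitz_ode_exists[where ?x0.0 = x0, OF less_imp_le[OF T_pos] M_pos cont lip], assumption, rule that)
  then have "is_state T x0 b u x" by (simp add: is_state_def)
  then show ?thesis unfolding state_def by (rule someI[where P="is_state T x0 b u"])
qed

text \<open>This identifies explicitly constructed trajectories, such as convex combinations of
  states, with the chosen one.\<close>

lemma state_unique:
  assumes u: "u \<in> controls T U" and "is_state T x0 b u x" and "t \<in> {0..T}"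
  shows "state T x0 b u t = x t"
proof (rule lipschitz_ode_unique[where F="\<lambda>t x. b t x (u t)" and M=M])
  show "norm (b t x (u t) - b t y (u t)) \<le> M * norm (x - y)" if "t \<in> {0..T}" for t x y
    using lipschitz_coeffD[OF b_lipschitz that controlsD(3)[OF u that] controlsD(3)[OF u that]]
    by simp
qed (use assms is_state_state[OF u] in \<open>auto simp: is_state_def\<close>)

lemma state_continuous:
  assumes "u \<in> controls T U"
  shows "continuous_on {0..T} (state T x0 b u)"
  using is_state_state[OF assms] unfolding is_state_def
  by (meson continuous_on_eq_continuous_within has_vector_derivative_continuous)

text \<open>The adjoint equation is affine in \<open>p\<close>. Its coefficients are continuous in
  time along the state, and the derivative bound for \<open>b\<close> supplies the Lipschitz
  constant \<open>M\<close>.\<close>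

lemma is_costate_costate:
  assumes u: "u \<in> controls T U"
  shows "is_costate T b' f' g' u (state T x0 b u) (costate T x0 b b' f' g' u)"
proof -
  define x where "x = state T x0 b u"
  define F where "F t p = - grad_x_hamiltonian0 b' f' t (x t) p (u t)" for t p
  have F_inner: "F t p \<bullet> k = f' t (x t) (u t) (k, 0) - p \<bullet> b' t (x t) (u t) (k, 0)" for t p k
    by (simp add: F_def grad_x_hamiltonian0_inner)
  note x_cont = state_continuous[OF u, folded x_def]
  have "continuous_on ({0..T} \<times> UNIV) (\<lambda>(t, p). F t p)"
  \<comment> \<open>Coordinatewise, because continuity of the \<open>x\<close>-derivatives is
    available for one fixed direction \<open>(i, 0)\<close> at a time.\<close>
  proof (subst continuous_on_componentwise, rule ballI)
    fix i :: "real^'d"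
    have 1: "continuous_on ({0..T} \<times> UNIV) (\<lambda>z. \<psi> (fst z))" if "continuous_on {0..T} \<psi>"
      for \<psi> :: "real \<Rightarrow> 'z::topological_space"
      by (rule continuous_on_compose2[OF that]) (auto intro!: continuous_intros)
    have "continuous_on ({0..T} \<times> UNIV)
      (\<lambda>z. f' (fst z) (x (fst z)) (u (fst z)) (i, 0) - snd z \<bullet> b' (fst z) (x (fst z)) (u (fst z)) (i, 0))"
      using M_pos
      by (intro continuous_intros
          1[OF smooth_coeff_part_x_continuous[OF f_lipschitz f_smooth _ x_cont controlsD(1,2)[OF u]]]
          1[OF smooth_coeff_part_x_continuous[OF b_lipschitz b_smooth _ x_cont controlsD(1,2)[OF u]]]) auto
    then show "continuous_on ({0..T} \<times> UNIV) (\<lambda>z. (case z of (t, p) \<Rightarrow> F t p) \<bullet> i)"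
      by (simp add: case_prod_unfold F_inner)
  qed
  moreover have "norm (F t p - F t q) \<le> M * norm (p - q)" if t: "t \<in> {0..T}" for t p q
  proof -
    define d where "d = F t p - F t q"
    have "norm d * norm d = d \<bullet> d" by (simp add: dot_square_norm power2_eq_square)
    \<comment> \<open>Testing the difference against itself cancels the terms from \<open>f\<close>
      and moves the adjoint of the \<open>x\<close>-derivative of \<open>b\<close> onto
      \<open>d\<close>.\<close>
    also have "\<dots> = (q - p) \<bullet> b' t (x t) (u t) (d, 0)"
      by (subst (1) d_def) (simp add: F_inner inner_diff_left)
    also have "\<dots> \<le> norm (q - p) * norm (b' t (x t) (u t) (d, 0))"
      by (rule norm_cauchy_schwarz)
    also have "\<dots> \<le> norm (q - p) * (M * norm d)"
      using smooth_coeff_derivative_bound[OF b_lipschitz b_smooth U_convex t, of "u t" 0 "x t" d]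
        controlsD(3)[OF u t]
      by (intro mult_left_mono) auto
    finally have "norm d * norm d \<le> (M * norm (p - q)) * norm d"
      by (simp add: norm_minus_commute ac_simps)
    then have "norm d \<le> M * norm (p - q)"
      using M_pos by (cases "d = 0") auto
    then show ?thesis by (simp add: d_def)
  qed
  ultimately obtain p where "p T = - g' (x T)"
    "\<And>t. t \<in> {0..T} \<Longrightarrow> (p has_vector_derivative F t (p t)) (at t within {0..T})"
    using lipschitz_ode_exists_terminal[of T M F "- g' (x T)"] T_pos M_pos by (metis less_imp_le)
  then have "is_costate T b' f' g' u (state T x0 b u) p"
    by (simp add: is_costate_def F_def x_def)
  then show ?thesis
    unfolding costate_def by (rule someI[where P="is_costate T b' f' g' u (state T x0 b u)"])
qed

lemma costate_continuous:
  assumes "u \<in> controls T U"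
  shows "continuous_on {0..T} (costate T x0 b b' f' g' u)"
  using is_costate_costate[OF assms] unfolding is_costate_def
  by (meson continuous_on_eq_continuous_within has_vector_derivative_continuous)

section \<open>Continuity along trajectories and splitting of the cost\<close>

lemma running_cost_continuous:
  assumes "u \<in> controls T U"
  shows "continuous_on {0..T} (\<lambda>t. f t (state T x0 b u t) (u t))"
  using controlsD[OF assms] state_continuous[OF assms]
  by (intro lipschitz_coeff_continuous[OF f_lipschitz] continuous_intros) auto

lemma drift_continuous:
  assumes "u \<in> controls T U"
  shows "continuous_on {0..T} (\<lambda>t. b t (state T x0 b u t) (u t))"
  using controlsD[OF assms] state_continuous[OF assms]
  by (intro lipschitz_coeff_continuous[OF b_lipschitz] continuous_intros) auto

lemma h_continuous: "continuous_on U h"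
  unfolding continuous_on_eq_continuous_within
  using h_derivative has_derivative_continuous by blast

lemma h_control_continuous:
  assumes "u \<in> controls T U"
  shows "continuous_on {0..T} (\<lambda>t. h (u t))" "continuous_on {0..T} (\<lambda>t. h' (u t))"
  using controlsD[OF assms]
  by (auto intro!: continuous_on_compose2[OF h_continuous] continuous_on_compose2[OF h'_continuous])

lemma h'_inner_integrable:
  assumes "u \<in> controls T U" "v \<in> controls T U"
  shows "(\<lambda>t. h' (u t) \<bullet> (v t - u t)) integrable_on {0..T}"
  using h_control_continuous[OF assms(1)] controlsD[OF assms(1)] controlsD[OF assms(2)]
  by (intro integrable_continuous_interval continuous_intros)

lemma integral_bregman:
  assumes u: "u \<in> controls T U" and v: "v \<in> controls T U"
  shows "int_bregman T h h' v u = integral {0..T} (\<lambda>t. h (v t)) - integral {0..T} (\<lambda>t. h (u t))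
    - integral {0..T} (\<lambda>t. h' (u t) \<bullet> (v t - u t))"
  unfolding int_bregman_def bregman_def
  using h_control_continuous(1)[OF u, THEN integrable_continuous_interval]
    h_control_continuous(1)[OF v, THEN integrable_continuous_interval] h'_inner_integrable[OF u v]
  by (simp add: integral_diff integrable_diff)

text \<open>Splitting off the regularisation lets later arguments treat the cost with
  \<open>\<tau> = 0\<close> and the integral of \<open>h\<close> by different estimates.\<close>

lemma cost_eq:
  assumes u: "u \<in> controls T U"
  shows "cost T x0 \<tau> b f g h u = cost T x0 0 b f g h u + \<tau> * integral {0..T} (\<lambda>t. h (u t))"
proof -
  note 1 = running_cost_continuous[OF u, THEN integrable_continuous_interval]
  note 2 = h_control_continuous(1)[OF u, THEN integrable_continuous_interval]
  show ?thesis
    using integral_add[OF 1 integrable_on_mult_right[OF 2, of \<tau>]] by (simp add: cost_def)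
qed

section \<open>The lower bound by the adjoint gradient\<close>

text \<open>A concave function lies below its tangent at \<open>(x, u)\<close>. The slope is split
  into its \<open>x\<close>- and \<open>u\<close>-parts because the costate equation absorbs the
  first, while the second is the gradient term of the theorem.\<close>

lemma hamiltonian0_gradient_ineq:
  assumes t: "t \<in> {0..T}" and u: "u \<in> U" "v \<in> U"
  shows "hamiltonian0 b f t y p v - hamiltonian0 b f t x p u
    \<le> (p \<bullet> b' t x u (y - x, 0) - f' t x u (y - x, 0)) + (p \<bullet> b' t x u (0, v - u) - f' t x u (0, v - u))"
proof -
  have D: "((\<lambda>(x, w). - hamiltonian0 b f t x p w) has_derivative
      (\<lambda>k. - (p \<bullet> b' t x u k - f' t x u k))) (at (x, u) within UNIV \<times> U)"
    using smooth_coeff_has_derivative[OF b_smooth t u(1), of x]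
      smooth_coeff_has_derivative[OF f_smooth t u(1), of x]
    unfolding hamiltonian0_def case_prod_unfold by (intro derivative_intros)
  have C: "convex_on (UNIV \<times> U) (\<lambda>(x, w). - hamiltonian0 b f t x p w)"
    using H_concave[OF t, of p] by (simp add: concave_on_def case_prod_unfold)
  have s: "blinfun_apply A (k, w) = blinfun_apply A (k, 0) + blinfun_apply A (0, w)"
    for A :: "((real^'d) \<times> (real^'m)) \<Rightarrow>\<^sub>L ('e::real_normed_vector)" and k w
    by (simp flip: blinfun.add_right)
  show ?thesis
    using convex_on_gradient_ineq[OF C D, of "(y, v)"] u
    by (simp add: s[of _ "y - x" "v - u"] inner_add_right)
qed

text \<open>Dominated convergence: the difference quotients in direction \<open>v t - u t\<close>
  are continuous in \<open>t\<close>, converge pointwise, and are dominated through the Lipschitz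
  bound.\<close>

lemma u_derivative_integrable:
  assumes u: "u \<in> controls T U" and v: "v \<in> controls T U"
    and x: "continuous_on {0..T} x" and p: "continuous_on {0..T} p"
  shows "(\<lambda>t. p t \<bullet> b' t (x t) (u t) (0, v t - u t) - f' t (x t) (u t) (0, v t - u t)) integrable_on {0..T}"
proof -
  define w where "w s t = u t + s *\<^sub>R (v t - u t)" for s t
  define q where "q s t = p t \<bullet> ((b t (x t) (w s t) - b t (x t) (u t)) /\<^sub>R s)
    - (f t (x t) (w s t) - f t (x t) (u t)) /\<^sub>R s" for s t
  define s where "s n = 1 / real (Suc n)" for n
  have s: "0 < s n" "s n \<le> 1" for n by (auto simp: s_def)
  have w: "w (s n) \<in> controls T U" for n
    using controls_convex_combination[OF U_convex u v, of "s n"] s[of n] by (simp add: w_def[abs_def])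
  note U = controlsD(3)[OF u] controlsD(3)[OF w]
  show ?thesis
  proof (rule dominated_convergence(1)[where f="\<lambda>n. q (s n)"
        and h="\<lambda>t. (norm (p t) + 1) * (M * norm (v t - u t))"])
    show "q (s n) integrable_on {0..T}" for n
      unfolding q_def using controlsD[OF u] controlsD[OF w[of n]] x p
      by (intro integrable_continuous_interval continuous_intros
          lipschitz_coeff_continuous[OF f_lipschitz] lipschitz_coeff_continuous[OF b_lipschitz]) auto
    show "(\<lambda>t. (norm (p t) + 1) * (M * norm (v t - u t))) integrable_on {0..T}"
      using controlsD[OF u] controlsD[OF v] p
      by (intro integrable_continuous_interval continuous_intros) auto
    fix n t assume t: "t \<in> {0..T}"
    have quot: "norm ((\<psi> t (x t) (w (s n) t) - \<psi> t (x t) (u t)) /\<^sub>R s n) \<le> M * norm (v t - u t)"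
      if "lipschitz_coeff T U M \<psi>" for \<psi> :: "real \<Rightarrow> real^'d \<Rightarrow> real^'m \<Rightarrow> 'e::real_normed_vector"
      using lipschitz_coeffD[OF that t U(2)[OF t, of n] U(1)[OF t], of "x t" "x t"] s[of n]
      by (simp add: w_def inverse_eq_divide pos_divide_le_eq ac_simps)
    have "norm (q (s n) t) \<le> norm (p t \<bullet> ((b t (x t) (w (s n) t) - b t (x t) (u t)) /\<^sub>R s n))
        + norm ((f t (x t) (w (s n) t) - f t (x t) (u t)) /\<^sub>R s n)"
      unfolding q_def by (rule norm_triangle_ineq4)
    also have "\<dots> \<le> norm (p t) * (M * norm (v t - u t)) + M * norm (v t - u t)"
      by (intro add_mono quot[OF f_lipschitz] order_trans[OF Cauchy_Schwarz_ineq2[folded real_norm_def]]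
          mult_left_mono quot[OF b_lipschitz]) simp
    finally show "norm (q (s n) t) \<le> (norm (p t) + 1) * (M * norm (v t - u t))"
      by (simp add: algebra_simps)
  next
    fix t assume t: "t \<in> {0..T}"
    note lim = smooth_coeff_dir_quotient[OF _ U_convex t U(1)[OF t], of _ _ _ _ _ "v t - u t" "x t" 0, simplified]
    have "((\<lambda>s. q s t) \<longlongrightarrow> p t \<bullet> b' t (x t) (u t) (0, v t - u t) - f' t (x t) (u t) (0, v t - u t)) (at_right 0)"
      unfolding q_def w_def
      using lim[OF b_smooth] lim[OF f_smooth] controlsD(3)[OF v t] by (intro tendsto_intros) auto
    then show "(\<lambda>n. q (s n) t) \<longlonglongrightarrow> p t \<bullet> b' t (x t) (u t) (0, v t - u t) - f' t (x t) (u t) (0, v t - u t)"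
      using filterlim_inverse_Suc_at_right unfolding s_def by (rule filterlim_compose)
  qed
qed

text \<open>The core is the case \<open>\<tau> = 0\<close>. Restoring \<open>\<tau>\<close> adds the
  difference of the integrals of \<open>h\<close> to the left and the linear term in
  \<open>h'\<close> to the right; their discrepancy is exactly the Bregman divergence.\<close>

lemma cost_diff_ge_adjoint:
  fixes \<tau> :: real
  assumes u: "u \<in> controls T U" and v: "v \<in> controls T U"
  shows "cost T x0 \<tau> b f g h v - cost T x0 \<tau> b f g h u
    \<ge> - integral {0..T} (\<lambda>t. grad_u_hamiltonian \<tau> b' f' h' t
         (state T x0 b u t) (costate T x0 b b' f' g' u t) (u t) \<bullet> (v t - u t))
      + \<tau> * integral {0..T} (\<lambda>t. bregman h h' (v t) (u t))"
proof -
  define x where "x = state T x0 b u"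
  define y where "y = state T x0 b v"
  define p where "p = costate T x0 b b' f' g' u"
  note x = is_state_state[OF u, folded x_def, unfolded is_state_def]
  note y = is_state_state[OF v, folded y_def, unfolded is_state_def]
  note p = is_costate_costate[OF u, folded x_def p_def, unfolded is_costate_def]
  note cont = state_continuous[OF u, folded x_def] costate_continuous[OF u, folded p_def]
  define gx where "gx t = grad_x_hamiltonian0 b' f' t (x t) (p t) (u t) \<bullet> (y t - x t)" for t
  define gu where "gu t = p t \<bullet> b' t (x t) (u t) (0, v t - u t) - f' t (x t) (u t) (0, v t - u t)" for t
  define A where "A t = p t \<bullet> (b t (y t) (v t) - b t (x t) (u t)) - gx t" for t
  define \<Delta>f where "\<Delta>f t = f t (y t) (v t) - f t (x t) (u t)" for t
  \<comment> \<open>\<open>A\<close> is the derivative of \<open>p t \<bullet> (y t - x t)\<close>.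
    The boundary term at 0 vanishes since both states start at \<open>x0\<close>; the one at
    \<open>T\<close> brings in \<open>- g' (x T)\<close>.\<close>
  have A: "(A has_integral p T \<bullet> (y T - x T) - p 0 \<bullet> (y 0 - x 0)) {0..T}"
  proof (rule fundamental_theorem_of_calculus)
    fix t assume t: "t \<in> {0..T}"
    have 1: "((\<lambda>t. y t - x t) has_vector_derivative b t (y t) (v t) - b t (x t) (u t)) (at t within {0..T})"
      using x y t by (intro derivative_intros) auto
    have 2: "(p has_vector_derivative - grad_x_hamiltonian0 b' f' t (x t) (p t) (u t)) (at t within {0..T})"
      using p t by auto
    show "((\<lambda>t. p t \<bullet> (y t - x t)) has_vector_derivative A t) (at t within {0..T})"
      unfolding has_vector_derivative_def
      by (rule has_derivative_eq_rhs[OF has_derivative_inner[OF 2[unfolded has_vector_derivative_def]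
            1[unfolded has_vector_derivative_def]]])
        (simp add: A_def gx_def fun_eq_iff algebra_simps)
  qed (use T_pos in simp)
  have gu: "gu integrable_on {0..T}"
    unfolding gu_def by (rule u_derivative_integrable[OF u v cont])
  note f = running_cost_continuous[OF u, THEN integrable_continuous_interval, folded x_def]
    running_cost_continuous[OF v, THEN integrable_continuous_interval, folded y_def]
  have "integral {0..T} A - integral {0..T} gu = integral {0..T} (\<lambda>t. A t - gu t)"
    using A gu by (subst integral_diff) auto
  also have "\<dots> \<le> integral {0..T} \<Delta>f"
  proof (rule integral_le)
    show "(\<lambda>t. A t - gu t) integrable_on {0..T}" using A gu by (intro integrable_diff) auto
    show "\<Delta>f integrable_on {0..T}" unfolding \<Delta>f_def by (intro integrable_diff f)
    fix t assume t: "t \<in> {0..T}"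
    \<comment> \<open>The costate equation has put \<open>- gx\<close> into \<open>A\<close>, which
      cancels the \<open>x\<close>-part of the tangent bound and leaves only the running
      costs.\<close>
    show "A t - gu t \<le> \<Delta>f t"
      using hamiltonian0_gradient_ineq[OF t controlsD(3)[OF u t] controlsD(3)[OF v t], of "y t" "p t" "x t"]
      unfolding A_def gu_def gx_def \<Delta>f_def hamiltonian0_def grad_x_hamiltonian0_inner
      by (simp add: inner_diff_right)
  qed
  also have "\<dots> = integral {0..T} (\<lambda>t. f t (y t) (v t)) - integral {0..T} (\<lambda>t. f t (x t) (u t))"
    unfolding \<Delta>f_def by (intro integral_diff f)
  finally have "- (g' (x T) \<bullet> (y T - x T)) - integral {0..T} gu
      \<le> integral {0..T} (\<lambda>t. f t (y t) (v t)) - integral {0..T} (\<lambda>t. f t (x t) (u t))"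
    using x y p integral_unique[OF A] by simp
  moreover have "g' (x T) \<bullet> (y T - x T) \<le> g (y T) - g (x T)"
    by (rule convex_on_gradient_ineq[OF g_convex g_derivative]) auto
  ultimately have 0: "cost T x0 0 b f g h v - cost T x0 0 b f g h u \<ge> - integral {0..T} gu"
    by (simp add: cost_def x_def y_def)
  have "integral {0..T} (\<lambda>t. grad_u_hamiltonian \<tau> b' f' h' t (x t) (p t) (u t) \<bullet> (v t - u t))
      = integral {0..T} (\<lambda>t. gu t - \<tau> * (h' (u t) \<bullet> (v t - u t)))"
    unfolding gu_def grad_u_hamiltonian_inner ..
  also have "\<dots> = integral {0..T} gu - \<tau> * integral {0..T} (\<lambda>t. h' (u t) \<bullet> (v t - u t))"
    using gu h'_inner_integrable[OF u v] by (subst integral_diff) (auto intro: integrable_on_mult_right)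
  finally show ?thesis
    using 0 unfolding integral_bregman[OF u v, unfolded int_bregman_def] cost_eq[OF u, of \<tau>] cost_eq[OF v, of \<tau>] x_def p_def
    by (simp add: right_diff_distrib)
qed

section \<open>Affine dynamics and convexity of the cost\<close>

text \<open>Concavity of \<open>p \<bullet> b - f\<close> for all \<open>p\<close>, in particular for large multiples of
  \<open>\<plusminus>p\<close>, leaves no room for curvature of \<open>b\<close>.\<close>

lemma drift_affine:
  assumes t: "t \<in> {0..T}" and U: "u \<in> U" "v \<in> U" and s: "0 \<le> s" "s \<le> 1"
  shows "b t (x + s *\<^sub>R (y - x)) (u + s *\<^sub>R (v - u)) = b t x u + s *\<^sub>R (b t y v - b t x u)"
proof -
  \<comment> \<open>\<open>d\<close> and \<open>c\<close> are the deviations of \<open>b\<close> and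
    \<open>f\<close> from linear interpolation; concavity of the Hamiltonian at \<open>p\<close>
    says precisely \<open>p \<bullet> d \<ge> c\<close>.\<close>
  define d where "d = b t (x + s *\<^sub>R (y - x)) (u + s *\<^sub>R (v - u)) - (b t x u + s *\<^sub>R (b t y v - b t x u))"
  define c where "c = f t (x + s *\<^sub>R (y - x)) (u + s *\<^sub>R (v - u)) - (f t x u + s * (f t y v - f t x u))"
  have *: "p \<bullet> d \<ge> c" for p
  proof -
    have C: "convex_on (UNIV \<times> U) (\<lambda>(x, w). - hamiltonian0 b f t x p w)"
      using H_concave[OF t, of p] by (simp add: concave_on_def case_prod_unfold)
    have e: "(1 - s) *\<^sub>R (x, u) + s *\<^sub>R (y, v) = (x + s *\<^sub>R (y - x), u + s *\<^sub>R (v - u))"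
      by (simp add: algebra_simps)
    show ?thesis
      using convex_onD[OF C s, of "(x, u)" "(y, v)"] U unfolding e
      by (simp add: hamiltonian0_def d_def c_def inner_diff_right inner_add_right algebra_simps)
  qed
  have "d = 0"
  proof (rule ccontr)
    assume "d \<noteq> 0"
    \<comment> \<open>A nonzero linear functional of \<open>p\<close> is unbounded below; this
      multiple of \<open>d\<close> makes it equal \<open>c - 1\<close>.\<close>
    then have "(((c - 1) / (d \<bullet> d)) *\<^sub>R d) \<bullet> d = c - 1" by simp
    then show False using *[of "((c - 1) / (d \<bullet> d)) *\<^sub>R d"] by simp
  qed
  then show ?thesis by (simp add: d_def)
qed

text \<open>At \<open>p = 0\<close> the Hamiltonian is \<open>- f\<close>, so its concavity is joint
  convexity of the running cost.\<close>

lemma running_cost_convex: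
  assumes t: "t \<in> {0..T}" and U: "u \<in> U" "v \<in> U" and s: "0 \<le> s" "s \<le> 1"
  shows "f t (x + s *\<^sub>R (y - x)) (u + s *\<^sub>R (v - u)) \<le> (1 - s) * f t x u + s * f t y v"
proof -
  have C: "convex_on (UNIV \<times> U) (\<lambda>(x, w). - hamiltonian0 b f t x 0 w)"
    using H_concave[OF t, of 0] by (simp add: concave_on_def case_prod_unfold)
  have e: "(1 - s) *\<^sub>R (x, u) + s *\<^sub>R (y, v) = (x + s *\<^sub>R (y - x), u + s *\<^sub>R (v - u))"
    by (simp add: algebra_simps)
  show ?thesis
    using convex_onD[OF C s, of "(x, u)" "(y, v)"] U unfolding e
    by (simp add: hamiltonian0_def)
qed

text \<open>As \<open>b\<close> interpolates linearly along segments, the combination of the two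
  states solves the equation driven by the combined control; uniqueness concludes.\<close>

lemma state_affine:
  assumes u: "u \<in> controls T U" and v: "v \<in> controls T U" and s: "0 \<le> s" "s \<le> 1" and "t \<in> {0..T}"
  shows "state T x0 b (\<lambda>t. u t + s *\<^sub>R (v t - u t)) t
    = state T x0 b u t + s *\<^sub>R (state T x0 b v t - state T x0 b u t)"
proof (rule state_unique[OF controls_convex_combination[OF U_convex u v s]])
  note x = is_state_state[OF u, unfolded is_state_def]
  note y = is_state_state[OF v, unfolded is_state_def]
  show "is_state T x0 b (\<lambda>t. u t + s *\<^sub>R (v t - u t))
      (\<lambda>t. state T x0 b u t + s *\<^sub>R (state T x0 b v t - state T x0 b u t))"
    unfolding is_state_def
  proof (intro conjI ballI)
    show "state T x0 b u 0 + s *\<^sub>R (state T x0 b v 0 - state T x0 b u 0) = x0"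
      using x y by simp
    fix t assume t: "t \<in> {0..T}"
    show "((\<lambda>t. state T x0 b u t + s *\<^sub>R (state T x0 b v t - state T x0 b u t)) has_vector_derivative
        b t (state T x0 b u t + s *\<^sub>R (state T x0 b v t - state T x0 b u t)) (u t + s *\<^sub>R (v t - u t)))
        (at t within {0..T})"
      unfolding drift_affine[OF t controlsD(3)[OF u t] controlsD(3)[OF v t] s]
      using x y t by (auto intro!: derivative_eq_intros)
  qed
qed fact

text \<open>States combine in the same proportion as controls, so \<open>f\<close>, \<open>g\<close>
  and \<open>h\<close> are evaluated at convex combinations; \<open>0 \<le> \<tau>\<close> preserves
  the inequality for \<open>h\<close>.\<close>

lemma cost_convex:
  assumes u: "u \<in> controls T U" and v: "v \<in> controls T U" and s: "0 \<le> s" "s \<le> 1" and "0 \<le> \<tau>"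
  shows "cost T x0 \<tau> b f g h (\<lambda>t. u t + s *\<^sub>R (v t - u t))
    \<le> (1 - s) * cost T x0 \<tau> b f g h u + s * cost T x0 \<tau> b f g h v"
proof -
  define L where "L u t = f t (state T x0 b u t) (u t) + \<tau> * h (u t)" for u t
  define w where "w t = u t + s *\<^sub>R (v t - u t)" for t
  have w: "w \<in> controls T U"
    unfolding w_def by (rule controls_convex_combination[OF U_convex u v s])
  have L: "L u integrable_on {0..T}" if "u \<in> controls T U" for u
    unfolding L_def using running_cost_continuous[OF that] h_control_continuous[OF that]
    by (intro integrable_continuous_interval continuous_intros)
  have xw: "state T x0 b w t = state T x0 b u t + s *\<^sub>R (state T x0 b v t - state T x0 b u t)" if "t \<in> {0..T}" for t
    unfolding w_def by (rule state_affine[OF u v s that])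
  have "integral {0..T} (L w) \<le> integral {0..T} (\<lambda>t. (1 - s) * L u t + s * L v t)"
  proof (rule integral_le[OF L[OF w]])
    show "(\<lambda>t. (1 - s) * L u t + s * L v t) integrable_on {0..T}"
      by (intro integrable_add integrable_on_mult_right L u v)
    fix t assume t: "t \<in> {0..T}"
    note U = controlsD(3)[OF u t] controlsD(3)[OF v t]
    have "\<tau> * h (w t) \<le> \<tau> * ((1 - s) * h (u t) + s * h (v t))"
      using convex_onD[OF h_convex s U] \<open>0 \<le> \<tau>\<close> by (intro mult_left_mono) (simp_all add: w_def algebra_simps)
    moreover have "f t (state T x0 b w t) (w t)
        \<le> (1 - s) * f t (state T x0 b u t) (u t) + s * f t (state T x0 b v t) (v t)"
      using running_cost_convex[OF t U s, of "state T x0 b u t" "state T x0 b v t"]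
      unfolding xw[OF t] by (simp add: w_def)
    ultimately show "L w t \<le> (1 - s) * L u t + s * L v t"
      by (simp add: L_def algebra_simps)
  qed
  also have "\<dots> = (1 - s) * integral {0..T} (L u) + s * integral {0..T} (L v)"
    using L[OF u] L[OF v] by (subst integral_add) (auto intro: integrable_on_mult_right)
  finally have I: "integral {0..T} (L w) \<le> (1 - s) * integral {0..T} (L u) + s * integral {0..T} (L v)" .
  have T: "T \<in> {0..T}" using T_pos by simp
  have "g (state T x0 b w T) \<le> (1 - s) * g (state T x0 b u T) + s * g (state T x0 b v T)"
    using convex_onD[OF g_convex s, of "state T x0 b u T" "state T x0 b v T"]
    unfolding xw[OF T] by (simp add: algebra_simps)
  with I show ?thesis
    by (simp add: cost_def L_def[abs_def] w_def[abs_def] algebra_simps)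
qed

section \<open>The directional derivative of the cost\<close>

text \<open>Convexity provides the dominating function: each quotient lies between the slope
  \<open>h' (u t) \<bullet> (v t - u t)\<close> and the full increment
  \<open>h (v t) - h (u t)\<close>.\<close>

lemma integral_h_dir_quotient:
  assumes u: "u \<in> controls T U" and v: "v \<in> controls T U"
  shows "(\<lambda>n. integral {0..T} (\<lambda>t. (h (u t + (1 / real (Suc n)) *\<^sub>R (v t - u t)) - h (u t)) /\<^sub>R (1 / real (Suc n))))
    \<longlonglongrightarrow> integral {0..T} (\<lambda>t. h' (u t) \<bullet> (v t - u t))"
proof (rule dominated_convergence(2)[where h="\<lambda>t. \<bar>h (v t) - h (u t)\<bar> + \<bar>h' (u t) \<bullet> (v t - u t)\<bar>"])
  fix n
  define s where "s = 1 / real (Suc n)"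
  have s: "0 < s" "s \<le> 1" by (auto simp: s_def)
  have w: "(\<lambda>t. u t + s *\<^sub>R (v t - u t)) \<in> controls T U"
    using s by (intro controls_convex_combination U_convex u v) auto
  show "(\<lambda>t. (h (u t + (1 / real (Suc n)) *\<^sub>R (v t - u t)) - h (u t)) /\<^sub>R (1 / real (Suc n))) integrable_on {0..T}"
    unfolding s_def[symmetric] using h_control_continuous(1)[OF w] h_control_continuous(1)[OF u]
    by (intro integrable_continuous_interval continuous_intros)
  show "norm ((h (u t + (1 / real (Suc n)) *\<^sub>R (v t - u t)) - h (u t)) /\<^sub>R (1 / real (Suc n)))
      \<le> \<bar>h (v t) - h (u t)\<bar> + \<bar>h' (u t) \<bullet> (v t - u t)\<bar>" if t: "t \<in> {0..T}" for t
  proof -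
    note U = controlsD(3)[OF u t] controlsD(3)[OF v t] controlsD(3)[OF w t]
    have 1: "s * (h' (u t) \<bullet> (v t - u t)) \<le> h (u t + s *\<^sub>R (v t - u t)) - h (u t)"
      using convex_on_gradient_ineq[OF h_convex h_derivative[OF U(1)] U(1) U(3)] by simp
    have 2: "h (u t + s *\<^sub>R (v t - u t)) - h (u t) \<le> s * (h (v t) - h (u t))"
      using convex_onD[OF h_convex _ _ U(1,2), of s] s by (simp add: algebra_simps)
    have "h' (u t) \<bullet> (v t - u t) \<le> (h (u t + s *\<^sub>R (v t - u t)) - h (u t)) /\<^sub>R s"
      using 1 s by (simp add: inverse_eq_divide pos_le_divide_eq mult.commute)
    moreover have "(h (u t + s *\<^sub>R (v t - u t)) - h (u t)) /\<^sub>R s \<le> h (v t) - h (u t)"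
      using 2 s by (simp add: inverse_eq_divide pos_divide_le_eq mult.commute)
    ultimately show ?thesis unfolding s_def[symmetric] real_norm_def by linarith
  qed
next
  show "(\<lambda>t. \<bar>h (v t) - h (u t)\<bar> + \<bar>h' (u t) \<bullet> (v t - u t)\<bar>) integrable_on {0..T}"
    using h_control_continuous[OF u] h_control_continuous[OF v] controlsD[OF u] controlsD[OF v]
    by (intro integrable_continuous_interval continuous_intros)
  fix t assume t: "t \<in> {0..T}"
  note U = controlsD(3)[OF u t] controlsD(3)[OF v t]
  show "(\<lambda>n. (h (u t + (1 / real (Suc n)) *\<^sub>R (v t - u t)) - h (u t)) /\<^sub>R (1 / real (Suc n)))
      \<longlonglongrightarrow> h' (u t) \<bullet> (v t - u t)"
    by (rule filterlim_compose[OF has_derivative_imp_dir_quotient[OF h_derivative[OF U(1)] U_convex U(1)]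
          filterlim_inverse_Suc_at_right]) (simp add: U)
qed

text \<open>\<open>dir_deriv\<close> is defined through \<open>Lim\<close>, whose value carries
  information only once convergence is known.\<close>

lemma cost_dir_deriv_exists:
  assumes u: "u \<in> controls T U" and v: "v \<in> controls T U" and "0 \<le> \<tau>"
  obtains L where
    "((\<lambda>s. (cost T x0 \<tau> b f g h (\<lambda>t. u t + s *\<^sub>R (v t - u t)) - cost T x0 \<tau> b f g h u) / s) \<longlongrightarrow> L) (at_right 0)"
proof -
  define w where "w s t = u t + s *\<^sub>R (v t - u t)" for s t
  define J where "J = cost T x0 \<tau> b f g h"
  define p where "p = costate T x0 b b' f' g' u"
  define C where "C = - integral {0..T}
    (\<lambda>t. grad_u_hamiltonian \<tau> b' f' h' t (state T x0 b u t) (p t) (u t) \<bullet> (v t - u t))"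
  have w: "w s \<in> controls T U" if "0 < s" "s \<le> 1" for s
    unfolding w_def using that by (intro controls_convex_combination U_convex u v) auto
  have mono: "(J (w s) - J u) / s \<le> (J (w r) - J u) / r" if "0 < s" "s \<le> r" "r \<le> 1" for s r
  proof -
    \<comment> \<open>\<open>w s\<close> is the point with parameter \<open>s / r\<close> on the
      segment from \<open>u\<close> to \<open>w r\<close>, so convexity compares the two
      quotients.\<close>
    have "w s = (\<lambda>t. u t + (s / r) *\<^sub>R (w r t - u t))" using that by (auto simp: w_def)
    then have "J (w s) \<le> (1 - s / r) * J u + (s / r) * J (w r)"
      using cost_convex[OF u w _ _ \<open>0 \<le> \<tau>\<close>, of r "s / r"] that by (simp add: J_def)
    then have "J (w s) - J u \<le> s * ((J (w r) - J u) / r)"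
      by (simp add: algebra_simps diff_divide_distrib)
    then show ?thesis using that by (simp add: pos_divide_le_eq mult.commute)
  qed
  \<comment> \<open>The adjoint bound is applied to \<open>w s\<close>: its increment is
    \<open>s\<close> times that of \<open>v\<close>, so the gradient integral scales to
    \<open>s * C\<close>, and the Bregman term is nonnegative.\<close>
  have bound: "C \<le> (J (w s) - J u) / s" if s: "0 < s" "s \<le> 1" for s
  proof -
    have "0 \<le> integral {0..T} (\<lambda>t. bregman h h' (w s t) (u t))"
    proof (rule integral_nonneg)
      show "(\<lambda>t. bregman h h' (w s t) (u t)) integrable_on {0..T}"
        unfolding bregman_def
        using h_control_continuous[OF u] h_control_continuous[OF w[OF s]] controlsD[OF u] controlsD[OF w[OF s]]
        by (intro integrable_continuous_interval continuous_intros)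
      show "0 \<le> bregman h h' (w s t) (u t)" if t: "t \<in> {0..T}" for t
        using convex_on_gradient_ineq[OF h_convex h_derivative controlsD(3)[OF u t] controlsD(3)[OF w[OF s] t]]
          controlsD(3)[OF u t] by (simp add: bregman_def)
    qed
    moreover have "- integral {0..T} (\<lambda>t. grad_u_hamiltonian \<tau> b' f' h' t (state T x0 b u t) (p t) (u t) \<bullet> (w s t - u t)) = s * C"
      by (simp add: w_def C_def)
    ultimately have "s * C \<le> J (w s) - J u"
      using cost_diff_ge_adjoint[OF u w[OF s], of \<tau>] mult_nonneg_nonneg[OF \<open>0 \<le> \<tau>\<close>]
      by (simp add: J_def p_def) (smt (verit))
    then show ?thesis using s by (simp add: pos_le_divide_eq mult.commute)
  qed
  from mono bound show thesis
    using tendsto_at_right_mono_bounded[of 0 1 "\<lambda>s. (J (w s) - J u) / s" C] that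
    by (auto simp: J_def w_def[abs_def])
qed

text \<open>Convexity is applied only to the part with \<open>\<tau> = 0\<close>. Bounding the
  \<open>h\<close>-quotient by its value at the end of the segment would lose the Bregman term, so
  that quotient is taken to its limit instead.\<close>

lemma cost_diff_ge_dir_deriv:
  assumes u: "u \<in> controls T U" and v: "v \<in> controls T U" and "0 \<le> \<tau>"
  shows "cost T x0 \<tau> b f g h v - cost T x0 \<tau> b f g h u
    \<ge> dir_deriv (cost T x0 \<tau> b f g h) u (\<lambda>t. v t - u t) + \<tau> * int_bregman T h h' v u"
proof -
  define w where "w s t = u t + s *\<^sub>R (v t - u t)" for s t
  define J where "J r = cost T x0 r b f g h" for r
  define s where "s n = 1 / real (Suc n)" for n
  define H where "H s = integral {0..T} (\<lambda>t. (h (w s t) - h (u t)) /\<^sub>R s)" for s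
  obtain L where L: "((\<lambda>s. (J \<tau> (w s) - J \<tau> u) / s) \<longlongrightarrow> L) (at_right 0)"
    using cost_dir_deriv_exists[OF assms] by (auto simp: J_def w_def[abs_def])
  have "dir_deriv (J \<tau>) u (\<lambda>t. v t - u t) = L"
    unfolding dir_deriv_def using L by (intro tendsto_Lim) (simp_all add: w_def[abs_def])
  \<comment> \<open>By \<open>cost_eq\<close> and \<open>integral_bregman\<close>, the right-hand
    side is \<open>J \<tau> v - J \<tau> u\<close> minus \<open>\<tau>\<close> times the integrated
    Bregman divergence.\<close>
  moreover have "L \<le> J 0 v - J 0 u + \<tau> * integral {0..T} (\<lambda>t. h' (u t) \<bullet> (v t - u t))"
  proof (rule LIMSEQ_le)
    show "(\<lambda>n. (J \<tau> (w (s n)) - J \<tau> u) / s n) \<longlonglongrightarrow> L"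
      unfolding s_def by (rule filterlim_compose[OF L filterlim_inverse_Suc_at_right])
    show "(\<lambda>n. J 0 v - J 0 u + \<tau> * H (s n)) \<longlonglongrightarrow>
        J 0 v - J 0 u + \<tau> * integral {0..T} (\<lambda>t. h' (u t) \<bullet> (v t - u t))"
      unfolding H_def w_def s_def by (intro tendsto_intros integral_h_dir_quotient[OF u v])
    have "(J \<tau> (w (s n)) - J \<tau> u) / s n \<le> J 0 v - J 0 u + \<tau> * H (s n)" for n
    proof -
      have s: "0 < s n" "s n \<le> 1" by (auto simp: s_def)
      have w: "w (s n) \<in> controls T U"
        unfolding w_def using s by (intro controls_convex_combination U_convex u v) auto
      note I = h_control_continuous(1)[OF w, THEN integrable_continuous_interval]
        h_control_continuous(1)[OF u, THEN integrable_continuous_interval]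
      have "H (s n) = (integral {0..T} (\<lambda>t. h (w (s n) t)) - integral {0..T} (\<lambda>t. h (u t))) / s n"
        by (simp add: H_def integral_diff[OF I] inverse_eq_divide)
      then have "\<tau> * H (s n) = \<tau> * integral {0..T} (\<lambda>t. h (w (s n) t)) / s n - \<tau> * integral {0..T} (\<lambda>t. h (u t)) / s n"
        by (simp add: right_diff_distrib diff_divide_distrib)
      moreover have "J 0 (w (s n)) \<le> (1 - s n) * J 0 u + s n * J 0 v"
        unfolding J_def w_def using cost_convex[OF u v _ _ order_refl] s by simp
      then have "J 0 (w (s n)) - J 0 u \<le> s n * (J 0 v - J 0 u)"
        by (simp add: algebra_simps)
      then have "(J 0 (w (s n)) - J 0 u) / s n \<le> J 0 v - J 0 u"
        using s by (simp add: pos_divide_le_eq mult.commute)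
      ultimately show ?thesis
        unfolding J_def cost_eq[OF u, of \<tau>] cost_eq[OF w, of \<tau>]
        by (simp add: add_divide_distrib diff_divide_distrib)
    qed
    then show "\<exists>N. \<forall>n\<ge>N. (J \<tau> (w (s n)) - J \<tau> u) / s n \<le> J 0 v - J 0 u + \<tau> * H (s n)" by blast
  qed
  ultimately show ?thesis
    unfolding J_def cost_eq[OF u, of \<tau>] cost_eq[OF v, of \<tau>] integral_bregman[OF u v]
    by (simp add: right_diff_distrib)
qed

end

theorem theorem4:
  fixes T \<tau> M Mbuu Mfuu :: real
    and x0 :: "real^'d"
    and U :: "(real^'m) set"
    and b :: "real \<Rightarrow> real^'d \<Rightarrow> real^'m \<Rightarrow> real^'d"
    and b' :: "real \<Rightarrow> real^'d \<Rightarrow> real^'m \<Rightarrow> (((real^'d) \<times> (real^'m)) \<Rightarrow>\<^sub>L (real^'d))"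
    and b'' :: "real \<Rightarrow> real^'d \<Rightarrow> real^'m \<Rightarrow> (((real^'d) \<times> (real^'m)) \<Rightarrow>\<^sub>L (((real^'d) \<times> (real^'m)) \<Rightarrow>\<^sub>L (real^'d)))"
    and f :: "real \<Rightarrow> real^'d \<Rightarrow> real^'m \<Rightarrow> real"
    and f' :: "real \<Rightarrow> real^'d \<Rightarrow> real^'m \<Rightarrow> (((real^'d) \<times> (real^'m)) \<Rightarrow>\<^sub>L real)"
    and f'' :: "real \<Rightarrow> real^'d \<Rightarrow> real^'m \<Rightarrow> (((real^'d) \<times> (real^'m)) \<Rightarrow>\<^sub>L (((real^'d) \<times> (real^'m)) \<Rightarrow>\<^sub>L real))"
    and g :: "real^'d \<Rightarrow> real" and g' :: "real^'d \<Rightarrow> real^'d"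
    and h :: "real^'m \<Rightarrow> real" and h' :: "real^'m \<Rightarrow> real^'m"
    and u v :: "real \<Rightarrow> real^'m"
  assumes "T > 0" and "\<tau> \<ge> 0" and "M > 0" and "Mbuu > 0" and "Mfuu > 0"
    and U: "U \<noteq> {}" "closed U" "convex U"
    and lipschitz: "lipschitz_coeff T U M b" "lipschitz_coeff T U M f"
    and smooth: "smooth_coeff T U M Mbuu b b' b''" "smooth_coeff T U M Mfuu f f' f''"
    and g_C1: "\<And>x. (g has_derivative (\<lambda>k. g' x \<bullet> k)) (at x)" "continuous_on UNIV g'"
    and g_bounds: "\<And>x x'. max \<bar>g x - g x'\<bar> (norm (g' x - g' x')) \<le> M * norm (x - x')" "\<bar>g 0\<bar> \<le> M"
    and h_convex: "convex_on U h"
    and h_C1: "\<And>w. w \<in> U \<Longrightarrow> (h has_derivative (\<lambda>k. h' w \<bullet> k)) (at w within U)" "continuous_on U h'"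
    and minimizer: "\<exists>us \<in> controls T U. \<forall>w \<in> controls T U.
      cost T x0 \<tau> b f g h us \<le> cost T x0 \<tau> b f g h w"
    and g_convex: "convex_on UNIV g"
    and H_concave: "\<And>t p. t \<in> {0..T} \<Longrightarrow> concave_on (UNIV \<times> U) (\<lambda>(x, w). hamiltonian0 b f t x p w)"
    and u: "u \<in> controls T U" and v: "v \<in> controls T U"
  shows "cost T x0 \<tau> b f g h v - cost T x0 \<tau> b f g h u
           \<ge> dir_deriv (cost T x0 \<tau> b f g h) u (\<lambda>t. v t - u t) + \<tau> * int_bregman T h h' v u
       \<and> cost T x0 \<tau> b f g h v - cost T x0 \<tau> b f g h u
           \<ge> - integral {0..T} (\<lambda>t. grad_u_hamiltonian \<tau> b' f' h' t
                   (state T x0 b u t) (costate T x0 b b' f' g' u t) (u t) \<bullet> (v t - u t))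
             + \<tau> * integral {0..T} (\<lambda>t. bregman h h' (v t) (u t))"
proof -
  interpret concave_hamiltonian_problem T M Mbuu Mfuu x0 U b b' b'' f f' f'' g g' h h'
    by unfold_locales fact+
  show ?thesis
    using cost_diff_ge_dir_deriv[OF u v \<open>0 \<le> \<tau>\<close>] cost_diff_ge_adjoint[OF u v] by simp
qed

end
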